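(* Let $X, X_1, X_2, \ldots$ be i.i.d. random elements of $L_2(\mathcal{I})$, $\mathcal{I}=[0,1]$, and let $\varepsilon_1,\varepsilon_2,\ldots$ be i.i.d. real random variables with zero mean and finite variance, independent of the $X_i$'s. For a functional $g: L_2(\mathcal{I})\to\mathbb{R}$ put $Y_i = g(X_i)+\varepsilon_i$. Fix $x\in L_2(\mathcal{I})$, and let $$\hat g(x)=\frac{\sum_{i=1}^n Y_i\,K(\|x-X_i\|/h)}{\sum_{i=1}^n K(\|x-X_i\|/h)} .$$ Assume that, for some $c>0$, the kernel $K$ is nonincreasing on $[0,c]$ and has support equal to $[0,c]$. Let $c_1=c$ if $K(c)>0$, and otherwise let $c_1\in(0,c)$. Assume that the bandwidth $h=h(n)>0$ satisfies $h\to0$ and $nP(\|X-x\|\le c_1h)\to\infty$ as $n\to\infty$. Write $\mathcal{X}=\{X_1,\ldots,X_n\}$. Let $\alpha\in(0,1]$, and for $C>0$ let $\mathcal{G}(C,x,\alpha)$ be the set of functionals $g$ such that $|g(x+\delta y)-g(x)|\le C\delta^\alpha$ for all $y\in L_2(\mathcal{I})$ with $\|y\|\le1$ and all $0\le\delta\le1$. Then: (i) If $g$ is continuous at $x$ in the sense that $\sup_{y:\|y\|\le1}|g(x+\delta y)-g(x)|\to0$ as $\delta\downarrow0$, then $\hat g(x)\to g(x)$ in mean square conditional on $\mathcal{X}$, i.e. $E[\{\hat g(x)-g(x)\}^2\mid\mathcal{X}]\to0$ in probability. (ii) For each $C>0$, $$\sup_{g\in\mathcal{G}(C,x,\alpha)}E[\{\hat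 g(x)-g(x)\}^2\mid\mathcal{X}]=o_p(1),$$ and, for all $\eta>0$, $$\sup_{g\in\mathcal{G}(C,x,\alpha)}P\{|\hat g(x)-g(x)|>\eta\}\to0 .$$ (iii) If moreover $h$ is chosen so that $h^{2\alpha}P(\|X-x\|\le c_1h)\asymp n^{-1}$ as $n\to\infty$, then for each $C>0$ $$\sup_{g\in\mathcal{G}(C,x,\alpha)}E[\{\hat g(x)-g(x)\}^2\mid\mathcal{X}]=O_p(h^{2\alpha})$$ and $$\lim_{C_1\to\infty}\limsup_{n\to\infty}\sup_{g\in\mathcal{G}(C,x,\alpha)}P\{|\hat g(x)-g(x)|>C_1h^\alpha\}=0 .$$
   Context: $\|\cdot\|$ is the standard norm of $L_2(\mathcal{I})$, the space of square-integrable functions on $\mathcal{I}=[0,1]$. A kernel is a nonnegative function $K:[0,\infty)\to[0,\infty)$. Functionals $g$ are real-valued and (Borel) measurable. All pairs $(X_i,\varepsilon_i)$ are defined on one probability space with a distribution not depending on $g$; only $Y_i=Y_i(g)=g(X_i)+\varepsilon_i$ changes with $g$, and $E[\,\cdot\mid\mathcal{X}]$ and $P$ are taken under the distribution of the data $(X_i,Y_i(g))$, $1\le i\le n$, for the given $g$. The estimator $\hat g(x)$ may be given any fixed value when its denominator vanishes. The notation $a_n\asymp b_n$ means that $a_n/b_n$ is bounded away from zero and infinity for all large $n$; $o_p$ and $O_p$ refer to $n\to\infty$. The bandwidth $h$ is deterministic. *)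

theory Defs
  imports "HOL-Probability.Probability" "HOL-Library.Landau_Symbols"
begin

section \<open>The Hilbert space of square-integrable functions on the unit interval\<close>

definition square_integrable :: "(real \<Rightarrow> real) \<Rightarrow> bool" where
  "square_integrable f \<longleftrightarrow>
     f \<in> borel_measurable (lebesgue_on {0..1}) \<and>
     integrable (lebesgue_on {0..1}) (\<lambda>t. (f t)\<^sup>2)"

definition L2_rel :: "(real \<Rightarrow> real) \<Rightarrow> (real \<Rightarrow> real) \<Rightarrow> bool" where
  "L2_rel f g \<longleftrightarrow>
     square_integrable f \<and> square_integrable g \<and> (AE t in lebesgue_on {0..1}. f t = g t)"

lemma square_integrable_zero: "square_integrable (\<lambda>t. 0)"
  by (simp add: square_integrable_def)

lemma square_integrable_mult:
  assumes "square_integrable f" "square_integrable g"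
  shows "integrable (lebesgue_on {0..1}) (\<lambda>t. f t * g t)"
proof (rule Bochner_Integration.integrable_bound)
  show "integrable (lebesgue_on {0..1}) (\<lambda>t. (f t)\<^sup>2 + (g t)\<^sup>2)"
    using assms by (auto simp: square_integrable_def)
  show "(\<lambda>t. f t * g t) \<in> borel_measurable (lebesgue_on {0..1})"
    using assms by (auto simp: square_integrable_def)
  have "\<bar>a * b\<bar> \<le> a\<^sup>2 + b\<^sup>2" for a b :: real
  proof -
    have "2 * \<bar>a * b\<bar> \<le> a\<^sup>2 + b\<^sup>2"
      using sum_squares_bound[of "\<bar>a\<bar>" "\<bar>b\<bar>"] by (simp add: abs_mult)
    then show ?thesis using abs_ge_zero[of "a * b"] by linarith
  qed
  then show "AE t in lebesgue_on {0..1}. norm (f t * g t) \<le> norm ((f t)\<^sup>2 + (g t)\<^sup>2)"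
    by simp
qed

lemma square_integrable_add:
  assumes "square_integrable f" "square_integrable g"
  shows "square_integrable (\<lambda>t. f t + g t)"
proof -
  have "integrable (lebesgue_on {0..1}) (\<lambda>t. (f t)\<^sup>2 + (g t)\<^sup>2 + 2 * (f t * g t))"
    using assms square_integrable_mult[OF assms] by (auto simp: square_integrable_def)
  then show ?thesis
    using assms by (auto simp: square_integrable_def power2_sum algebra_simps)
qed

lemma square_integrable_scale:
  "square_integrable f \<Longrightarrow> square_integrable (\<lambda>t. r * f t)"
  by (auto simp: square_integrable_def power_mult_distrib)

lemma L2_rel_part_equivp: "part_equivp L2_rel"
proof (rule part_equivpI)
  show "\<exists>f. L2_rel f f"
    using square_integrable_zero by (auto simp: L2_rel_def)
  show "symp L2_rel"
    by (auto simp: symp_def L2_rel_def elim: AE_mp)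
  show "transp L2_rel"
  proof (rule transpI)
    fix f g k assume *: "L2_rel f g" "L2_rel g k"
    then have "AE t in lebesgue_on {0..1}. f t = g t" "AE t in lebesgue_on {0..1}. g t = k t"
      by (auto simp: L2_rel_def)
    then have "AE t in lebesgue_on {0..1}. f t = k t" by eventually_elim simp
    with * show "L2_rel f k" by (auto simp: L2_rel_def)
  qed
qed

quotient_type L2 = "real \<Rightarrow> real" / partial: L2_rel
  by (rule L2_rel_part_equivp)

instantiation L2 :: real_inner
begin

lift_definition zero_L2 :: L2 is "\<lambda>t. 0"
  by (simp add: L2_rel_def square_integrable_zero)

lift_definition plus_L2 :: "L2 \<Rightarrow> L2 \<Rightarrow> L2" is "\<lambda>f g t. f t + g t"
  by (auto simp: L2_rel_def square_integrable_add)

lift_definition scaleR_L2 :: "real \<Rightarrow> L2 \<Rightarrow> L2" is "\<lambda>r f t. r * f t"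
  by (auto simp: L2_rel_def square_integrable_scale)

lift_definition uminus_L2 :: "L2 \<Rightarrow> L2" is "\<lambda>f t. - f t"
  by (auto simp: L2_rel_def square_integrable_def)

definition minus_L2 :: "L2 \<Rightarrow> L2 \<Rightarrow> L2" where
  "minus_L2 f g = f + (- g)"

lift_definition inner_L2 :: "L2 \<Rightarrow> L2 \<Rightarrow> real" is
  "\<lambda>f g. integral\<^sup>L (lebesgue_on {0..1}) (\<lambda>t. f t * g t)"
proof -
  fix f f' g g' :: "real \<Rightarrow> real"
  assume *: "L2_rel f f'" "L2_rel g g'"
  show "integral\<^sup>L (lebesgue_on {0..1}) (\<lambda>t. f t * g t) =
        integral\<^sup>L (lebesgue_on {0..1}) (\<lambda>t. f' t * g' t)"
    by (rule integral_cong_AE) (use * in \<open>auto simp: L2_rel_def square_integrable_def\<close>)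
qed

lift_definition norm_L2 :: "L2 \<Rightarrow> real" is
  "\<lambda>f. sqrt (integral\<^sup>L (lebesgue_on {0..1}) (\<lambda>t. (f t)\<^sup>2))"
proof -
  fix f f' :: "real \<Rightarrow> real"
  assume *: "L2_rel f f'"
  have "integral\<^sup>L (lebesgue_on {0..1}) (\<lambda>t. (f t)\<^sup>2) =
        integral\<^sup>L (lebesgue_on {0..1}) (\<lambda>t. (f' t)\<^sup>2)"
    by (rule integral_cong_AE) (use * in \<open>auto simp: L2_rel_def square_integrable_def\<close>)
  then show "sqrt (integral\<^sup>L (lebesgue_on {0..1}) (\<lambda>t. (f t)\<^sup>2)) =
        sqrt (integral\<^sup>L (lebesgue_on {0..1}) (\<lambda>t. (f' t)\<^sup>2))"
    by simp
qed

definition dist_L2 :: "L2 \<Rightarrow> L2 \<Rightarrow> real" where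
  "dist_L2 f g = norm (f - g)"

definition sgn_L2 :: "L2 \<Rightarrow> L2" where
  "sgn_L2 f = inverse (norm f) *\<^sub>R f"

definition uniformity_L2 :: "(L2 \<times> L2) filter" where
  "uniformity_L2 = (INF e\<in>{0 <..}. principal {(f, g). dist f g < e})"

definition open_L2 :: "L2 set \<Rightarrow> bool" where
  "open_L2 U \<longleftrightarrow> (\<forall>f\<in>U. eventually (\<lambda>(f', g). f' = f \<longrightarrow> g \<in> U) uniformity)"

instance
proof
  fix f g k :: L2 and r s :: real
  show "f + g + k = f + (g + k)"
    by transfer (auto simp: L2_rel_def square_integrable_add add.assoc)
  show "f + g = g + f"
    by transfer (auto simp: L2_rel_def square_integrable_add add.commute)
  show "0 + f = f"
    by transfer (auto simp: L2_rel_def)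
  show "- f + f = 0"
    by transfer (auto simp: L2_rel_def square_integrable_zero)
  show "f - g = f + - g"
    by (rule minus_L2_def)
  show "r *\<^sub>R (f + g) = r *\<^sub>R f + r *\<^sub>R g"
    by transfer (simp add: L2_rel_def square_integrable_add square_integrable_scale distrib_left)
  show "(r + s) *\<^sub>R f = r *\<^sub>R f + s *\<^sub>R f"
    by transfer (simp add: L2_rel_def square_integrable_add square_integrable_scale distrib_right)
  show "r *\<^sub>R s *\<^sub>R f = (r * s) *\<^sub>R f"
    by transfer (simp add: L2_rel_def square_integrable_scale mult.assoc)
  show "1 *\<^sub>R f = f"
    by transfer (simp add: L2_rel_def)
  show "sgn f = inverse (norm f) *\<^sub>R f"
    by (rule sgn_L2_def)
  show "dist f g = norm (f - g)"
    by (rule dist_L2_def)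
  show "(uniformity :: (L2 \<times> L2) filter) = (INF e\<in>{0 <..}. principal {(f, g). dist f g < e})"
    by (rule uniformity_L2_def)
  show "open U \<longleftrightarrow> (\<forall>f\<in>U. eventually (\<lambda>(f', g). f' = f \<longrightarrow> g \<in> U) uniformity)"
    for U :: "L2 set"
    by (rule open_L2_def)
  show "inner f g = inner g f"
    by transfer (simp add: mult.commute)
  show "inner (f + g) k = inner f k + inner g k"
    by transfer (simp add: L2_rel_def distrib_right square_integrable_mult)
  show "inner (r *\<^sub>R f) g = r * inner f g"
    by transfer (simp add: mult.assoc)
  show "0 \<le> inner f f"
    by transfer (simp add: integral_nonneg_AE)
  show "inner f f = 0 \<longleftrightarrow> f = 0"
  proof transfer
    fix f assume "L2_rel f f"
    then have f: "square_integrable f" by (simp add: L2_rel_def)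
    have "integral\<^sup>L (lebesgue_on {0..1}) (\<lambda>t. f t * f t) = 0 \<longleftrightarrow>
          (AE t in lebesgue_on {0..1}. f t * f t = 0)"
      by (rule integral_nonneg_eq_0_iff_AE) (auto intro: square_integrable_mult f)
    then show "integral\<^sup>L (lebesgue_on {0..1}) (\<lambda>t. f t * f t) = 0 \<longleftrightarrow> L2_rel f (\<lambda>t. 0)"
      using f by (simp add: L2_rel_def square_integrable_zero)
  qed
  show "norm f = sqrt (inner f f)"
    by transfer (simp add: power2_eq_square)
qed

end


section \<open>Essential supremum of a family of random variables\<close>

text \<open>
  Conditional expectations are determined only up to null sets, so the supremum of an uncountable
  family of them is the essential supremum: the almost surely smallest measurable function
  that dominates every member almost surely.
\<close>

definition is_ess_Sup :: "'a measure \<Rightarrow> ('a \<Rightarrow> ennreal) set \<Rightarrow> ('a \<Rightarrow> ennreal) \<Rightarrow> bool" where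
  "is_ess_Sup M F U \<longleftrightarrow>
     U \<in> borel_measurable M \<and>
     (\<forall>f\<in>F. AE \<omega> in M. f \<omega> \<le> U \<omega>) \<and>
     (\<forall>V\<in>borel_measurable M. (\<forall>f\<in>F. AE \<omega> in M. f \<omega> \<le> V \<omega>) \<longrightarrow> (AE \<omega> in M. U \<omega> \<le> V \<omega>))"

definition ess_Sup :: "'a measure \<Rightarrow> ('a \<Rightarrow> ennreal) set \<Rightarrow> ('a \<Rightarrow> ennreal)" where
  "ess_Sup M F = (SOME U. is_ess_Sup M F U)"

lemma is_ess_Sup_unique:
  "is_ess_Sup M F U \<Longrightarrow> is_ess_Sup M F V \<Longrightarrow> AE \<omega> in M. U \<omega> = V \<omega>"
proof -
  assume "is_ess_Sup M F U" "is_ess_Sup M F V"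
  then have "AE \<omega> in M. U \<omega> \<le> V \<omega>" "AE \<omega> in M. V \<omega> \<le> U \<omega>"
    by (auto simp: is_ess_Sup_def)
  then show ?thesis by eventually_elim simp
qed

lemma inverse_one_plus_antimono:
  fixes a b :: ennreal
  assumes "a \<le> b"
  shows "inverse (1 + b) \<le> inverse (1 + a)"
  using assms
proof (cases a; cases b)
  fix r s assume "a = ennreal r" "0 \<le> r" "b = ennreal s" "0 \<le> s"
  then show ?thesis
    using assms
    by (simp add: ennreal_1[symmetric] ennreal_plus[symmetric] inverse_ennreal ennreal_leI
          le_imp_inverse_le del: ennreal_1 ennreal_plus)
qed (auto simp: top_unique)

lemma inverse_one_plus_inj:
  fixes a b :: ennreal
  assumes "inverse (1 + a) = inverse (1 + b)"
  shows "a = b"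
  using assms
proof (cases a; cases b)
  fix r s assume *: "a = ennreal r" "0 \<le> r" "b = ennreal s" "0 \<le> s"
  then have "inverse (1 + r) = inverse (1 + s)"
    using assms
    by (simp add: ennreal_1[symmetric] ennreal_plus[symmetric] inverse_ennreal
          del: ennreal_1 ennreal_plus)
  then show ?thesis using * by simp
next
  fix r assume *: "a = ennreal r" "0 \<le> r" "b = top"
  then have "inverse (1 + a) = 0" using assms by simp
  then have "1 + a = top" by (simp only: ennreal_inverse_eq_0_iff)
  then show ?thesis using * by simp
next
  fix s assume *: "a = top" "b = ennreal s" "0 \<le> s"
  then have "inverse (1 + b) = 0" using assms by simp
  then have "1 + b = top" by (simp only: ennreal_inverse_eq_0_iff)
  then show ?thesis using * by simp
qed simp

lemma is_ess_Sup_ess_Sup: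
  assumes "finite_measure M" and F: "F \<subseteq> borel_measurable M"
  shows "is_ess_Sup M F (ess_Sup M F)"
proof -
  interpret finite_measure M by fact
  define S where "S C \<omega> = (SUP f\<in>C. f \<omega>)" for C :: "('a \<Rightarrow> ennreal) set" and \<omega>
  define J where "J C = (\<integral>\<^sup>+\<omega>. inverse (1 + S C \<omega>) \<partial>M)" for C
  define D where "D = {C. countable C \<and> C \<subseteq> F}"
  have D0: "{} \<in> D" by (simp add: D_def)
  have meas: "S C \<in> borel_measurable M" if "C \<in> D" for C
    unfolding S_def using that F by (intro borel_measurable_SUP) (auto simp: D_def)
  have inv_mono: "inverse (1 + b) \<le> inverse (1 + a)" if "a \<le> b" for a b :: ennreal
    using that by (rule inverse_one_plus_antimono)
  have inv_inj: "u = v" if "inverse (1 + u) = inverse (1 + v)" for u v :: ennreal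
    using that by (rule inverse_one_plus_inj)
  have S_mono: "S C \<omega> \<le> S C' \<omega>" if "C \<subseteq> C'" for C C' \<omega>
    unfolding S_def using that by (rule SUP_subset_mono) simp
  have J_mono: "J C' \<le> J C" if "C \<subseteq> C'" for C C'
    unfolding J_def by (intro nn_integral_mono inv_mono S_mono that)
  have "J ` D \<noteq> {}" using D0 by auto
  then obtain Q where Q: "range Q \<subseteq> J ` D" "Inf (J ` D) = (INF i::nat. Q i)"
    using ennreal_Inf_countable_INF[of "J ` D"] by (metis image_subset_iff)
  then have "\<forall>i. \<exists>C. C \<in> D \<and> Q i = J C" by blast
  then obtain C where C: "\<And>i. C i \<in> D" "\<And>i. Q i = J (C i)" by metis
  define E where "E = (\<Union>i. C i)"
  have E: "E \<in> D" using C(1) by (auto simp: E_def D_def)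
  have JE: "J E \<le> J B" if "B \<in> D" for B
  proof -
    have "J E \<le> (INF i. Q i)"
      by (rule INF_greatest) (auto simp: C(2) E_def intro: J_mono)
    also have "\<dots> \<le> J B" unfolding Q(2)[symmetric] using that by (simp add: INF_lower)
    finally show ?thesis .
  qed
  have "is_ess_Sup M F (S E)"
    unfolding is_ess_Sup_def
  proof (intro conjI ballI impI)
    show "S E \<in> borel_measurable M" by (rule meas[OF E])
  next
    fix f assume f: "f \<in> F"
    define E' where "E' = insert f E"
    have E': "E' \<in> D" using E f by (auto simp: E'_def D_def)
    note [measurable] = meas[OF E] meas[OF E']
    have sub: "E \<subseteq> E'" by (auto simp: E'_def)
    have fin: "J E' \<noteq> \<infinity>"
    proof -
      have "J E' \<le> (\<integral>\<^sup>+\<omega>. 1 \<partial>M)"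
        unfolding J_def
      proof (rule nn_integral_mono)
        fix \<omega>
        show "inverse (1 + S E' \<omega>) \<le> 1"
          using inv_mono[of 0 "S E' \<omega>"] by simp
      qed
      also have "\<dots> < \<infinity>" using finite_emeasure_space by (simp add: less_top[symmetric])
      finally show ?thesis by simp
    qed
    have "(\<integral>\<^sup>+\<omega>. inverse (1 + S E \<omega>) - inverse (1 + S E' \<omega>) \<partial>M) = J E - J E'"
      unfolding J_def
      by (rule nn_integral_diff) (use fin in \<open>auto simp: J_def intro!: inv_mono S_mono sub\<close>)
    also have "\<dots> = 0"
      using fin JE[OF E'] J_mono[OF sub] by (intro diff_eq_0_ennreal) (auto simp: less_top intro: antisym)
    finally have "AE \<omega> in M. inverse (1 + S E \<omega>) - inverse (1 + S E' \<omega>) = 0"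
      by (subst (asm) nn_integral_0_iff_AE) auto
    then show "AE \<omega> in M. f \<omega> \<le> S E \<omega>"
    proof eventually_elim
      case (elim \<omega>)
      have "inverse (1 + S E' \<omega>) = inverse (1 + S E \<omega>)"
      proof (rule antisym)
        show "inverse (1 + S E' \<omega>) \<le> inverse (1 + S E \<omega>)" by (intro inv_mono S_mono sub)
        show "inverse (1 + S E \<omega>) \<le> inverse (1 + S E' \<omega>)"
          using elim by (simp add: ennreal_minus_eq_0)
      qed
      then have "S E' \<omega> = S E \<omega>" by (rule inv_inj)
      moreover have "f \<omega> \<le> S E' \<omega>" unfolding S_def E'_def by (rule SUP_upper) simp
      ultimately show ?case by simp
    qed
  next
    fix V :: "'a \<Rightarrow> ennreal" assume "\<forall>f\<in>F. AE \<omega> in M. f \<omega> \<le> V \<omega>"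
    then have "AE \<omega> in M. \<forall>f\<in>E. f \<omega> \<le> V \<omega>"
      using E by (subst AE_ball_countable) (auto simp: D_def)
    then show "AE \<omega> in M. S E \<omega> \<le> V \<omega>"
      by eventually_elim (auto simp: S_def intro: SUP_least)
  qed
  then show ?thesis unfolding ess_Sup_def by (rule someI[where P="is_ess_Sup M F"])
qed


section \<open>Stochastic order symbols\<close>

definition in_prob_to_zero :: "'a measure \<Rightarrow> (nat \<Rightarrow> 'a \<Rightarrow> ennreal) \<Rightarrow> bool" where
  "in_prob_to_zero M Z \<longleftrightarrow>
     (\<forall>\<eta>>0. (\<lambda>n. measure M {\<omega> \<in> space M. ennreal \<eta> < Z n \<omega>}) \<longlonglongrightarrow> 0)"

definition big_O_in_prob :: "'a measure \<Rightarrow> (nat \<Rightarrow> 'a \<Rightarrow> ennreal) \<Rightarrow> (nat \<Rightarrow> real) \<Rightarrow> bool" where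
  "big_O_in_prob M Z a \<longleftrightarrow>
     (\<forall>e>0. \<exists>B>0. \<forall>\<^sub>F n in sequentially.
        measure M {\<omega> \<in> space M. ennreal (B * a n) < Z n \<omega>} < e)"


section \<open>The regression model and the kernel estimator\<close>

definition iid_vars :: "'a measure \<Rightarrow> 'b measure \<Rightarrow> (nat \<Rightarrow> 'a \<Rightarrow> 'b) \<Rightarrow> nat set \<Rightarrow> bool" where
  "iid_vars M N Z I \<longleftrightarrow>
     prob_space.indep_vars M (\<lambda>_. N) Z I \<and>
     (\<forall>i\<in>I. \<forall>j\<in>I. distr M N (Z i) = distr M N (Z j))"

definition generated_algebra ::
    "'a measure \<Rightarrow> (nat \<Rightarrow> 'a \<Rightarrow> 'b::topological_space) \<Rightarrow> nat set \<Rightarrow> 'a measure" where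
  "generated_algebra M Z I =
     vimage_algebra (space M) (\<lambda>\<omega>. \<lambda>i\<in>I. Z i \<omega>) (Pi\<^sub>M I (\<lambda>_. borel))"

text \<open>Index \<open>0\<close> carries the generic random element, indices \<open>1, 2, \<dots>\<close> carry the sample.\<close>

definition regression_data ::
    "'a measure \<Rightarrow> (nat \<Rightarrow> 'a \<Rightarrow> L2) \<Rightarrow> (nat \<Rightarrow> 'a \<Rightarrow> real) \<Rightarrow> bool" where
  "regression_data M X \<epsilon> \<longleftrightarrow>
     iid_vars M borel X UNIV \<and>
     iid_vars M borel \<epsilon> {1..} \<and>
     (\<forall>i\<ge>1. integrable M (\<epsilon> i) \<and> integral\<^sup>L M (\<epsilon> i) = 0 \<and> integrable M (\<lambda>\<omega>. (\<epsilon> i \<omega>)\<^sup>2)) \<and>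
     prob_space.indep_set M (sets (generated_algebra M X {1..})) (sets (generated_algebra M \<epsilon> {1..}))"

text \<open>Only the values of \<open>K\<close> on \<open>[0,\<infinity>)\<close> matter. The support is the closure of the set where
  \<open>K\<close> does not vanish, so that \<open>K c = 0\<close> is possible.\<close>

definition admissible_kernel :: "(real \<Rightarrow> real) \<Rightarrow> real \<Rightarrow> bool" where
  "admissible_kernel K c \<longleftrightarrow>
     (\<forall>u\<ge>0. 0 \<le> K u) \<and> antimono_on {0..c} K \<and> closure {u. 0 \<le> u \<and> K u \<noteq> 0} = {0..c}"

text \<open>The value \<open>d\<close> is returned when the denominator vanishes.\<close>

definition kernel_estimate ::
    "real \<Rightarrow> (real \<Rightarrow> real) \<Rightarrow> real \<Rightarrow> nat \<Rightarrow> (nat \<Rightarrow> L2) \<Rightarrow> (nat \<Rightarrow> real) \<Rightarrow> L2 \<Rightarrow> real" where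
  "kernel_estimate d K b n xs ys x =
     (if (\<Sum>i=1..n. K (norm (x - xs i) / b)) = 0 then d
      else (\<Sum>i=1..n. ys i * K (norm (x - xs i) / b)) / (\<Sum>i=1..n. K (norm (x - xs i) / b)))"

definition g_hat ::
    "real \<Rightarrow> (real \<Rightarrow> real) \<Rightarrow> (nat \<Rightarrow> real) \<Rightarrow> (nat \<Rightarrow> 'a \<Rightarrow> L2) \<Rightarrow> (nat \<Rightarrow> 'a \<Rightarrow> real) \<Rightarrow>
     L2 \<Rightarrow> nat \<Rightarrow> (L2 \<Rightarrow> real) \<Rightarrow> 'a \<Rightarrow> real" where
  "g_hat d K h X \<epsilon> x n g \<omega> =
     kernel_estimate d K (h n) n (\<lambda>i. X i \<omega>) (\<lambda>i. g (X i \<omega>) + \<epsilon> i \<omega>) x"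

text \<open>The squared error is nonnegative but need not be integrable for every \<open>n\<close>, whence the
  extended nonnegative conditional expectation.\<close>

definition cond_mse ::
    "'a measure \<Rightarrow> real \<Rightarrow> (real \<Rightarrow> real) \<Rightarrow> (nat \<Rightarrow> real) \<Rightarrow> (nat \<Rightarrow> 'a \<Rightarrow> L2) \<Rightarrow>
     (nat \<Rightarrow> 'a \<Rightarrow> real) \<Rightarrow> L2 \<Rightarrow> nat \<Rightarrow> (L2 \<Rightarrow> real) \<Rightarrow> 'a \<Rightarrow> ennreal" where
  "cond_mse M d K h X \<epsilon> x n g =
     nn_cond_exp M (generated_algebra M X {1..n}) (\<lambda>\<omega>. ennreal ((g_hat d K h X \<epsilon> x n g \<omega> - g x)\<^sup>2))"

definition continuous_functional_at :: "(L2 \<Rightarrow> real) \<Rightarrow> L2 \<Rightarrow> bool" where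
  "continuous_functional_at g x \<longleftrightarrow>
     ((\<lambda>\<delta>. SUP y\<in>{y. norm y \<le> 1}. ennreal \<bar>g (x + \<delta> *\<^sub>R y) - g x\<bar>) \<longlongrightarrow> 0) (at_right (0::real))"

definition holder_class :: "real \<Rightarrow> L2 \<Rightarrow> real \<Rightarrow> (L2 \<Rightarrow> real) set" where
  "holder_class C x \<alpha> =
     {g \<in> borel_measurable borel.
        \<forall>y \<delta>. norm y \<le> 1 \<longrightarrow> 0 \<le> \<delta> \<longrightarrow> \<delta> \<le> 1 \<longrightarrow> \<bar>g (x + \<delta> *\<^sub>R y) - g x\<bar> \<le> C * \<delta> powr \<alpha>}"

end

theory Submission
  imports Defs
begin

text \<open>
  The kernel vanishes beyond \<open>c\<close> and is at least \<open>K c1 > 0\<close> on \<open>[0, c1]\<close>. The estimator is therefore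
  a convex combination of responses observed within distance \<open>c * h\<close> of \<open>x\<close>, and its denominator is
  at least \<open>K c1\<close> times the number \<open>N\<close> of design points within distance \<open>c1 * h\<close>. That number is
  binomial with mean \<open>n * p\<close>, where \<open>p\<close> is the small ball probability, so Chebyshev's inequality
  bounds the probability of \<open>N < n * p / 2\<close> by \<open>4 / (n * p)\<close> (\<open>prob_not_crowded\<close>). On the
  complementary event, called \<open>crowded\<close> below, the error splits into two parts.

  \<^item> The bias is a weighted mean of \<open>g (X i) - g x\<close> over points in the ball of radius \<open>c * h\<close>, hence at
    most the oscillation \<open>B\<close> of \<open>g\<close> on that ball.

  \<^item> The noise is a weighted sum of errors. Given the design these are uncorrelated, so its
    conditional second moment is the error variance times the sum of the squared weights
    (\<open>noise_conditional_second_moment\<close>). No weight exceeds \<open>K 0\<close> divided by the denominator, which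
    makes this sum of order \<open>1 / (n * p)\<close> (\<open>sum_weight_squares\<close>).

  On the event \<open>crowded\<close> the conditional mean squared error is thus at most
  \<open>2 * B\<^sup>2\<close> plus a multiple of \<open>1 / (n * p)\<close> (\<open>cond_mse_bound\<close>). This bound sees \<open>g\<close> only through
  \<open>B\<close>. It therefore passes to the essential supremum over a class (\<open>ess_Sup_cond_mse_bound\<close>) and,
  by Markov's inequality, to unconditional error probabilities (\<open>prob_error_bound\<close>).

  Outside \<open>crowded\<close> nothing is claimed about the conditional error. Where the denominator vanishes the
  supremum over a Hoelder class is even infinite, because \<open>g x\<close> is unrestricted while the estimate is
  the fixed default. Convergence in probability tolerates this, since the event has
  vanishing probability.

  All three assertions are limits of these finite sample bounds. By continuity \<open>B\<close> tends to zero, and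
  in a Hoelder class \<open>B\<close> can be taken as \<open>C * (c * h) powr \<alpha>\<close>. The last assertion concerns
  bandwidths for which \<open>1 / (n * p)\<close> and the squared bias are both of order \<open>h powr (2 * \<alpha>)\<close>.
\<close>


section \<open>Sigma-algebras generated by a family of random variables\<close>

lemma measurable_generated_algebra:
  assumes "i \<in> I"
  shows "Z i \<in> borel_measurable (generated_algebra M Z I)"
proof -
  have "(\<lambda>\<omega>. (\<lambda>j\<in>I. Z j \<omega>) i) \<in> borel_measurable (generated_algebra M Z I)"
    unfolding generated_algebra_def
    by (rule measurable_compose[OF measurable_vimage_algebra1 measurable_component_singleton])
       (use assms in \<open>auto simp: space_PiM\<close>)
  then show ?thesis using assms by simp
qed

lemma sets_generated_algebra_le:
  assumes "space N = space M" and "\<And>i. i \<in> I \<Longrightarrow> Z i \<in> borel_measurable N"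
  shows "sets (generated_algebra M Z I) \<subseteq> sets N"
  unfolding generated_algebra_def
  by (rule sets_image_in_sets) (use assms in \<open>auto intro!: measurable_restrict\<close>)

lemma space_generated_algebra [simp]: "space (generated_algebra M Z I) = space M"
  by (simp add: generated_algebra_def)

lemma subalgebra_generated_algebra:
  assumes "\<And>i. i \<in> I \<Longrightarrow> Z i \<in> borel_measurable M"
  shows "subalgebra M (generated_algebra M Z I)"
  using sets_generated_algebra_le[of M M I Z] assms by (auto simp: subalgebra_def)

lemma subalgebra_generated_algebra_mono:
  assumes "J \<subseteq> I"
  shows "subalgebra (generated_algebra M Z I) (generated_algebra M Z J)"
  using sets_generated_algebra_le[of "generated_algebra M Z I" M J Z] assms
  by (auto simp: subalgebra_def intro: measurable_generated_algebra)


section \<open>Second moments\<close>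

lemma integrable_mult_square_integrable:
  fixes f g :: "'a \<Rightarrow> real"
  assumes "f \<in> borel_measurable M" "g \<in> borel_measurable M"
    and "integrable M (\<lambda>\<omega>. (f \<omega>)\<^sup>2)" "integrable M (\<lambda>\<omega>. (g \<omega>)\<^sup>2)"
  shows "integrable M (\<lambda>\<omega>. f \<omega> * g \<omega>)"
proof (rule Bochner_Integration.integrable_bound)
  show "integrable M (\<lambda>\<omega>. (f \<omega>)\<^sup>2 + (g \<omega>)\<^sup>2)"
    using assms by simp
  have "\<bar>a * b\<bar> \<le> a\<^sup>2 + b\<^sup>2" for a b :: real
  proof -
    have "2 * \<bar>a * b\<bar> \<le> a\<^sup>2 + b\<^sup>2"
      using sum_squares_bound[of "\<bar>a\<bar>" "\<bar>b\<bar>"] by (simp add: abs_mult)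
    then show ?thesis using abs_ge_zero[of "a * b"] by linarith
  qed
  then show "AE \<omega> in M. norm (f \<omega> * g \<omega>) \<le> norm ((f \<omega>)\<^sup>2 + (g \<omega>)\<^sup>2)"
    by simp
qed (use assms in measurable)

lemma second_moment_sum_orthogonal:
  fixes Z :: "'i \<Rightarrow> 'a \<Rightarrow> real"
  assumes "finite I"
    and meas: "\<And>i. i \<in> I \<Longrightarrow> Z i \<in> borel_measurable M"
    and sq: "\<And>i. i \<in> I \<Longrightarrow> integrable M (\<lambda>\<omega>. (Z i \<omega>)\<^sup>2)"
    and orth: "\<And>i j. i \<in> I \<Longrightarrow> j \<in> I \<Longrightarrow> i \<noteq> j \<Longrightarrow> (\<integral>\<omega>. Z i \<omega> * Z j \<omega> \<partial>M) = 0"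
  shows "integrable M (\<lambda>\<omega>. (\<Sum>i\<in>I. Z i \<omega>)\<^sup>2)"
    and "(\<integral>\<omega>. (\<Sum>i\<in>I. Z i \<omega>)\<^sup>2 \<partial>M) = (\<Sum>i\<in>I. \<integral>\<omega>. (Z i \<omega>)\<^sup>2 \<partial>M)"
proof -
  have expand: "(\<Sum>i\<in>I. Z i \<omega>)\<^sup>2 = (\<Sum>i\<in>I. \<Sum>j\<in>I. Z i \<omega> * Z j \<omega>)" for \<omega>
    by (simp add: power2_eq_square sum_product)
  have int: "integrable M (\<lambda>\<omega>. Z i \<omega> * Z j \<omega>)" if "i \<in> I" "j \<in> I" for i j
    using that by (intro integrable_mult_square_integrable meas sq)
  show "integrable M (\<lambda>\<omega>. (\<Sum>i\<in>I. Z i \<omega>)\<^sup>2)"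
    unfolding expand by (intro Bochner_Integration.integrable_sum int)
  have "(\<integral>\<omega>. (\<Sum>i\<in>I. Z i \<omega>)\<^sup>2 \<partial>M) = (\<Sum>i\<in>I. \<Sum>j\<in>I. \<integral>\<omega>. Z i \<omega> * Z j \<omega> \<partial>M)"
    unfolding expand by (simp add: int)
  also have "\<dots> = (\<Sum>i\<in>I. \<Sum>j\<in>I. if i = j then \<integral>\<omega>. (Z i \<omega>)\<^sup>2 \<partial>M else 0)"
    by (intro sum.cong refl) (auto simp: orth power2_eq_square)
  also have "\<dots> = (\<Sum>i\<in>I. \<integral>\<omega>. (Z i \<omega>)\<^sup>2 \<partial>M)"
    using \<open>finite I\<close> by simp
  finally show "(\<integral>\<omega>. (\<Sum>i\<in>I. Z i \<omega>)\<^sup>2 \<partial>M) = (\<Sum>i\<in>I. \<integral>\<omega>. (Z i \<omega>)\<^sup>2 \<partial>M)" .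
qed

context prob_space
begin

lemma iid_vars_moment_eq:
  fixes f :: "'b \<Rightarrow> real"
  assumes "iid_vars M N Z I" "i \<in> I" "j \<in> I" "f \<in> borel_measurable N"
  shows "expectation (\<lambda>\<omega>. f (Z i \<omega>)) = expectation (\<lambda>\<omega>. f (Z j \<omega>))"
proof -
  have Z: "Z i \<in> measurable M N" "Z j \<in> measurable M N"
    using assms(1-3) unfolding iid_vars_def indep_vars_def by blast+
  have "distr M N (Z i) = distr M N (Z j)"
    using assms(1-3) unfolding iid_vars_def by blast
  then show ?thesis
    using integral_distr[OF Z(1) assms(4)] integral_distr[OF Z(2) assms(4)] by metis
qed

lemma indep_vars_expectation_mult:
  fixes f :: "'b \<Rightarrow> real"
  assumes "indep_vars (\<lambda>_. N) Z I" "i \<in> I" "j \<in> I" "i \<noteq> j" "f \<in> borel_measurable N"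
    and "integrable M (\<lambda>\<omega>. f (Z i \<omega>))" "integrable M (\<lambda>\<omega>. f (Z j \<omega>))"
  shows "expectation (\<lambda>\<omega>. f (Z i \<omega>) * f (Z j \<omega>)) =
    expectation (\<lambda>\<omega>. f (Z i \<omega>)) * expectation (\<lambda>\<omega>. f (Z j \<omega>))"
proof -
  have "indep_vars (\<lambda>_. borel) (\<lambda>k \<omega>. f (Z k \<omega>)) {i, j}"
    using assms by (intro indep_vars_compose2[OF indep_vars_subset[OF assms(1)]]) auto
  then have "expectation (\<lambda>\<omega>. \<Prod>k\<in>{i, j}. f (Z k \<omega>)) =
      (\<Prod>k\<in>{i, j}. expectation (\<lambda>\<omega>. f (Z k \<omega>)))"
    by (rule indep_vars_lebesgue_integral[rotated]) (use assms in auto)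
  then show ?thesis using \<open>i \<noteq> j\<close> by simp
qed

text \<open>
  The design and the errors are independent as sigma-algebras, whereas the product formula for
  expectations speaks of two random variables. Each factor generates a smaller sigma-algebra.
\<close>

lemma indep_set_expectation_mult:
  fixes u v :: "'a \<Rightarrow> real"
  assumes indep: "indep_set (sets F) (sets G)" and sp: "space F = space M" "space G = space M"
    and u: "u \<in> borel_measurable F" "integrable M u"
    and v: "v \<in> borel_measurable G" "integrable M v"
  shows "expectation (\<lambda>\<omega>. u \<omega> * v \<omega>) = expectation u * expectation v"
    and "integrable M (\<lambda>\<omega>. u \<omega> * v \<omega>)"
proof -
  have sub: "sigma_sets (space M) {w -` A \<inter> space M | A. A \<in> sets borel} \<subseteq> sets H"
    if "w \<in> borel_measurable H" "space H = space M" for w :: "'a \<Rightarrow> real" and H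
    unfolding that(2)[symmetric]
    by (rule sets.sigma_sets_subset) (use that measurable_sets[OF that(1)] in \<open>auto\<close>)
  have "indep_set (sigma_sets (space M) {u -` A \<inter> space M | A. A \<in> sets borel})
      (sigma_sets (space M) {v -` A \<inter> space M | A. A \<in> sets borel})"
    using indep sub[OF u(1) sp(1)] sub[OF v(1) sp(2)] unfolding indep_sets2_eq by blast
  then have "indep_var borel u borel v"
    unfolding indep_var_eq by (intro conjI borel_measurable_integrable u(2) v(2))
  then show "expectation (\<lambda>\<omega>. u \<omega> * v \<omega>) = expectation u * expectation v"
    and "integrable M (\<lambda>\<omega>. u \<omega> * v \<omega>)"
    using u v by (auto intro: indep_var_lebesgue_integral indep_var_integrable)
qed

end


section \<open>The kernel\<close>

text \<open>
  The two ways of choosing \<open>c1\<close> serve one purpose, namely to make \<open>K c1\<close> positive: the kernel may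
  vanish at the boundary point \<open>c\<close> of its support, but not before it.
\<close>

lemma admissible_kernel_bounds:
  assumes K: "admissible_kernel K c" and "0 < c"
    and c1: "if 0 < K c then c1 = c else 0 < c1 \<and> c1 < c"
  shows "0 < c1" "c1 \<le> c" "0 < K c1"
    and "\<And>u. 0 \<le> u \<Longrightarrow> u \<le> c1 \<Longrightarrow> K c1 \<le> K u"
    and "\<And>u. 0 \<le> u \<Longrightarrow> K u \<le> K 0"
    and "\<And>u. c < u \<Longrightarrow> K u = 0"
proof -
  have nonneg: "0 \<le> K u" if "0 \<le> u" for u
    using K that by (simp add: admissible_kernel_def)
  have anti: "K v \<le> K u" if "0 \<le> u" "u \<le> v" "v \<le> c" for u v
    using K that by (auto simp: admissible_kernel_def monotone_on_def)
  have supp: "closure {u. 0 \<le> u \<and> K u \<noteq> 0} = {0..c}"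
    using K by (simp add: admissible_kernel_def)
  show c1_pos: "0 < c1" and c1_le: "c1 \<le> c"
    using c1 \<open>0 < c\<close> by (auto split: if_splits)
  show outside: "K u = 0" if "c < u" for u
    using subsetD[OF closure_subset[of "{u. 0 \<le> u \<and> K u \<noteq> 0}"], of u] that \<open>0 < c\<close>
    unfolding supp by auto
  show "0 < K c1"
  proof (cases "0 < K c")
    case True
    then show ?thesis using c1 by simp
  next
    case False
    then have "c1 < c" using c1 by simp
    \<comment> \<open>As \<open>c\<close> is a limit of points where \<open>K\<close> does not vanish, one of them exceeds \<open>c1\<close>.\<close>
    have "c \<in> closure {u. 0 \<le> u \<and> K u \<noteq> 0}" using supp \<open>0 < c\<close> by simp
    then obtain v where v: "0 \<le> v" "K v \<noteq> 0" "dist v c < c - c1"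
      using \<open>c1 < c\<close> unfolding closure_approachable by (auto dest: spec[of _ "c - c1"])
    then have "c1 \<le> v" "v \<le> c" using outside by (auto simp: dist_real_def not_less[symmetric])
    then have "K v \<le> K c1" using c1_pos by (intro anti) auto
    then show ?thesis using v nonneg[of v] by simp
  qed
  show "K c1 \<le> K u" if "0 \<le> u" "u \<le> c1" for u
    using that c1_le by (intro anti) auto
  show "K u \<le> K 0" if "0 \<le> u" for u
    using that anti[of 0 u] outside[of u] nonneg[of 0] by (cases "u \<le> c") auto
qed

text \<open>
  Monotonicity yields measurability, but nothing is known about \<open>K\<close> on the negative axis; the
  maximum with \<open>0\<close> hides these values and changes nothing at the nonnegative arguments that occur.
\<close>

lemma admissible_kernel_measurable:
  assumes K: "admissible_kernel K c" "0 < c"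
  shows "(\<lambda>u. K (max 0 u)) \<in> borel_measurable borel"
proof -
  have anti: "K v \<le> K u" if "0 \<le> u" "u \<le> v" for u v
  proof (cases "v \<le> c")
    case True
    then show ?thesis using K that by (auto simp: admissible_kernel_def monotone_on_def)
  next
    case False
    have "v \<notin> closure {u. 0 \<le> u \<and> K u \<noteq> 0}"
      using K False by (simp add: admissible_kernel_def)
    then have "K v = 0"
      using subsetD[OF closure_subset[of "{u. 0 \<le> u \<and> K u \<noteq> 0}"], of v] that by auto
    then show ?thesis using K that by (auto simp: admissible_kernel_def)
  qed
  have "mono (\<lambda>u. - K (max 0 u))"
    by (auto simp: mono_def intro!: anti)
  then have "(\<lambda>u. - (- K (max 0 u))) \<in> borel_measurable borel"
    by (intro borel_measurable_uminus borel_measurable_mono)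
  then show ?thesis by simp
qed


section \<open>Kernel weights and design points near the target\<close>

text \<open>
  The bounds before the asymptotics hold for each sample size separately; conditions on the
  bandwidths as \<open>n\<close> grows enter only afterwards.
\<close>

locale kernel_regression = prob_space M
  for M :: "'a measure" +
  fixes X :: "nat \<Rightarrow> 'a \<Rightarrow> L2" and \<epsilon> :: "nat \<Rightarrow> 'a \<Rightarrow> real"
    and K :: "real \<Rightarrow> real" and h :: "nat \<Rightarrow> real" and x :: L2
    and c c1 d :: real
  assumes data: "regression_data M X \<epsilon>"
    and c_pos: "0 < c" and kernel: "admissible_kernel K c"
    and c1: "if 0 < K c then c1 = c else 0 < c1 \<and> c1 < c"
    and h_pos: "\<And>n. 0 < h n"
begin

lemmas kernel_bounds = admissible_kernel_bounds[OF kernel c_pos c1]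

abbreviation kern :: "nat \<Rightarrow> nat \<Rightarrow> 'a \<Rightarrow> real" where
  "kern n i \<omega> \<equiv> K (norm (x - X i \<omega>) / h n)"

text \<open>
  Division by zero makes all weights vanish where the denominator does, so they are bounded by one
  everywhere.
\<close>

definition weight :: "nat \<Rightarrow> nat \<Rightarrow> 'a \<Rightarrow> real" where
  "weight n i \<omega> = kern n i \<omega> / (\<Sum>j=1..n. kern n j \<omega>)"

definition noise :: "nat \<Rightarrow> 'a \<Rightarrow> real" where
  "noise n \<omega> = (\<Sum>i=1..n. weight n i \<omega> * \<epsilon> i \<omega>)"

definition noise_variance :: real where
  "noise_variance = expectation (\<lambda>\<omega>. (\<epsilon> 1 \<omega>)\<^sup>2)"

definition small_ball :: "nat \<Rightarrow> real" where
  "small_ball n = prob {\<omega> \<in> space M. norm (X 0 \<omega> - x) \<le> c1 * h n}"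

definition neighbours :: "nat \<Rightarrow> 'a \<Rightarrow> real" where
  "neighbours n \<omega> = (\<Sum>i=1..n. indicator (cball x (c1 * h n)) (X i \<omega>))"

text \<open>
  At least half of the expected number of design points lie near \<open>x\<close>; any fixed
  fraction below one would do, as it leaves a deviation proportional to the mean.
\<close>

definition crowded :: "nat \<Rightarrow> 'a set" where
  "crowded n = {\<omega> \<in> space M. real n * small_ball n / 2 \<le> neighbours n \<omega>}"

abbreviation design :: "nat \<Rightarrow> 'a measure" where
  "design n \<equiv> generated_algebra M X {1..n}"

lemma X_indep: "indep_vars (\<lambda>_. borel) X UNIV"
  using data by (auto simp: regression_data_def iid_vars_def)

lemma X_measurable [measurable]: "X i \<in> borel_measurable M"
  using X_indep by (auto simp: indep_vars_def)

lemma eps_indep: "indep_vars (\<lambda>_. borel) \<epsilon> {1..}"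
  using data unfolding regression_data_def iid_vars_def by blast

lemma eps_measurable [measurable]: "1 \<le> i \<Longrightarrow> \<epsilon> i \<in> borel_measurable M"
  using eps_indep by (auto simp: indep_vars_def)

lemma eps_moments:
  assumes "1 \<le> i"
  shows "integrable M (\<epsilon> i)" "expectation (\<epsilon> i) = 0" "integrable M (\<lambda>\<omega>. (\<epsilon> i \<omega>)\<^sup>2)"
  using data assms by (auto simp: regression_data_def)

lemma eps_second_moment:
  assumes "1 \<le> i"
  shows "expectation (\<lambda>\<omega>. (\<epsilon> i \<omega>)\<^sup>2) = noise_variance"
  unfolding noise_variance_def
  by (rule iid_vars_moment_eq[where f="\<lambda>t. t\<^sup>2" and N=borel and I="{1..}"])
     (use data assms in \<open>auto simp: regression_data_def\<close>)

lemma noise_variance_nonneg: "0 \<le> noise_variance"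
  by (simp add: noise_variance_def)

lemma subalgebra_design: "subalgebra M (design n)"
  by (rule subalgebra_generated_algebra) measurable

lemma kern_nonneg: "0 \<le> kern n i \<omega>"
  using kernel h_pos[of n] by (auto simp: admissible_kernel_def)

lemma kern_measurable:
  assumes "i \<in> {1..n}"
  shows "(\<lambda>\<omega>. kern m i \<omega>) \<in> borel_measurable (design n)"
proof -
  note [measurable] = admissible_kernel_measurable[OF kernel c_pos]
  have "(\<lambda>y. norm (x - y) / h m) \<in> borel_measurable borel"
    using h_pos[of m] by (intro borel_measurable_continuous_onI continuous_intros) auto
  then have "(\<lambda>y. K (max 0 (norm (x - y) / h m))) \<in> borel_measurable borel"
    by measurable
  from measurable_compose[OF measurable_generated_algebra[OF assms] this]
  show ?thesis using h_pos[of m] by (simp add: max_absorb2 less_imp_le)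
qed

lemma weight_measurable:
  assumes "i \<in> {1..n}"
  shows "weight n i \<in> borel_measurable (design n)"
  unfolding weight_def using assms
  by (intro borel_measurable_divide borel_measurable_sum kern_measurable)

lemma weight_bounds:
  assumes "i \<in> {1..n}"
  shows "0 \<le> weight n i \<omega>" "weight n i \<omega> \<le> 1"
proof -
  have "kern n i \<omega> \<le> (\<Sum>j=1..n. kern n j \<omega>)"
    using assms by (intro member_le_sum kern_nonneg) auto
  then show "0 \<le> weight n i \<omega>" "weight n i \<omega> \<le> 1"
    using kern_nonneg[of i \<omega> n] by (auto simp: weight_def divide_le_eq_1)
qed

lemma crowded_in_design: "crowded n \<in> sets (design n)"
proof -
  have "(\<lambda>\<omega>. indicator (cball x (c1 * h n)) (X i \<omega>) :: real) \<in> borel_measurable (design n)"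
    if "i \<in> {1..n}" for i
    by (rule measurable_compose[OF measurable_generated_algebra[OF that]])
       (intro borel_measurable_indicator borel_closed closed_cball)
  then have "neighbours n \<in> borel_measurable (design n)"
    unfolding neighbours_def by (intro borel_measurable_sum)
  then have "{\<omega> \<in> space (design n). real n * small_ball n / 2 \<le> neighbours n \<omega>} \<in> sets (design n)"
    by measurable
  then show ?thesis by (simp add: crowded_def)
qed

lemma crowded_in_events [measurable]: "crowded n \<in> events"
  using crowded_in_design subalgebra_design by (auto simp: subalgebra_def)

text \<open>
  Chebyshev's inequality for a sum of independent indicators with success probability \<open>p\<close>: the
  variance is at most \<open>n * p\<close> and the deviation is at least \<open>n * p / 2\<close>.
\<close>

lemma prob_not_crowded:
  assumes np: "0 < real n * small_ball n"
  shows "prob (space M - crowded n) \<le> 4 / (real n * small_ball n)"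
proof -
  define p where "p = small_ball n"
  define A where "A = cball x (c1 * h n)"
  define f where "f y = indicator A y - p" for y
  have A [measurable]: "A \<in> sets borel" by (simp add: A_def)
  have [measurable]: "f \<in> borel_measurable borel" unfolding f_def by measurable
  have p: "expectation (\<lambda>\<omega>. indicator A (X i \<omega>)) = p" for i
  proof -
    have "expectation (\<lambda>\<omega>. indicator A (X i \<omega>)) = (expectation (\<lambda>\<omega>. indicator A (X 0 \<omega>)) :: real)"
      by (rule iid_vars_moment_eq[where N=borel and I=UNIV])
         (use data in \<open>auto simp: regression_data_def\<close>)
    also have "\<dots> = expectation (indicator {\<omega> \<in> space M. X 0 \<omega> \<in> A})"
      by (rule Bochner_Integration.integral_cong) (auto simp: indicator_def)
    also have "\<dots> = prob {\<omega> \<in> space M. X 0 \<omega> \<in> A}"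
      by simp
    finally show ?thesis
      by (simp add: p_def small_ball_def A_def dist_norm norm_minus_commute)
  qed
  have int_ind: "integrable M (\<lambda>\<omega>. indicator A (X i \<omega>) :: real)" for i
    by (rule integrable_const_bound[where B=1]) (auto simp: indicator_def)
  have int_f: "integrable M (\<lambda>\<omega>. f (X i \<omega>))" for i
    unfolding f_def using int_ind by simp
  have mean: "expectation (\<lambda>\<omega>. f (X i \<omega>)) = 0" for i
    unfolding f_def using int_ind by (simp add: p prob_space)
  \<comment> \<open>Indicators are idempotent, so the square is affine in the indicator.\<close>
  have f_sq: "(f y)\<^sup>2 = (1 - 2 * p) * indicator A y + p\<^sup>2" for y
    by (auto simp: f_def indicator_def power2_eq_square algebra_simps)
  have int_sq: "integrable M (\<lambda>\<omega>. (f (X i \<omega>))\<^sup>2)" for i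
    unfolding f_sq using int_ind by simp
  have var: "expectation (\<lambda>\<omega>. (f (X i \<omega>))\<^sup>2) \<le> p" for i
    unfolding f_sq using int_ind by (simp add: p prob_space power2_eq_square algebra_simps)
  have orth: "expectation (\<lambda>\<omega>. f (X i \<omega>) * f (X j \<omega>)) = 0" if "i \<noteq> j" for i j
    using indep_vars_expectation_mult[OF X_indep _ _ that, of f] by (simp add: int_f mean)
  note sum_sq = second_moment_sum_orthogonal[of "{1..n}" "\<lambda>i \<omega>. f (X i \<omega>)" M]
  have int: "integrable M (\<lambda>\<omega>. (\<Sum>i=1..n. f (X i \<omega>))\<^sup>2)"
    using int_sq orth by (intro sum_sq) auto
  have "expectation (\<lambda>\<omega>. (\<Sum>i=1..n. f (X i \<omega>))\<^sup>2) = (\<Sum>i=1..n. expectation (\<lambda>\<omega>. (f (X i \<omega>))\<^sup>2))"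
    using int_sq orth by (intro sum_sq) auto
  also have "\<dots> \<le> real n * p"
    using sum_mono[of "{1..n}", OF var] by simp
  finally have le: "expectation (\<lambda>\<omega>. (\<Sum>i=1..n. f (X i \<omega>))\<^sup>2) \<le> real n * p" .
  have np': "0 < real n * p" using np by (simp add: p_def)
  have "prob (space M - crowded n)
      \<le> prob {\<omega> \<in> space M. (real n * p / 2)\<^sup>2 \<le> (\<Sum>i=1..n. f (X i \<omega>))\<^sup>2}"
  proof (rule finite_measure_mono)
    show "space M - crowded n \<subseteq> {\<omega> \<in> space M. (real n * p / 2)\<^sup>2 \<le> (\<Sum>i=1..n. f (X i \<omega>))\<^sup>2}"
    proof
      fix \<omega> assume \<omega>: "\<omega> \<in> space M - crowded n"
      then have "neighbours n \<omega> < real n * p / 2"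
        by (auto simp: crowded_def p_def)
      moreover have "(\<Sum>i=1..n. f (X i \<omega>)) = neighbours n \<omega> - real n * p"
        by (simp add: f_def neighbours_def A_def sum_subtractf)
      ultimately have "real n * p / 2 \<le> \<bar>\<Sum>i=1..n. f (X i \<omega>)\<bar>" by linarith
      then have "(real n * p / 2)\<^sup>2 \<le> (\<Sum>i=1..n. f (X i \<omega>))\<^sup>2"
        using np' by (subst abs_le_square_iff[symmetric]) simp
      then show "\<omega> \<in> {\<omega> \<in> space M. (real n * p / 2)\<^sup>2 \<le> (\<Sum>i=1..n. f (X i \<omega>))\<^sup>2}"
        using \<omega> by simp
    qed
  qed measurable
  also have "\<dots> \<le> expectation (\<lambda>\<omega>. (\<Sum>i=1..n. f (X i \<omega>))\<^sup>2) / (real n * p / 2)\<^sup>2"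
    by (intro integral_Markov_inequality_measure[where A="space M"] int)
       (use zero_less_power[OF half_gt_zero[OF np'], of 2] in simp_all)
  also have "\<dots> \<le> real n * p / (real n * p / 2)\<^sup>2"
    by (intro divide_right_mono le) simp
  also have "\<dots> = 4 / (real n * p)"
    using np' by (simp add: power2_eq_square field_simps)
  finally show ?thesis by (simp add: p_def)
qed

text \<open>
  Each design point within distance \<open>c1 * h n\<close> contributes at least \<open>K c1\<close>.
\<close>

lemma kern_sum_lower:
  assumes "\<omega> \<in> crowded n"
  shows "K c1 * (real n * small_ball n / 2) \<le> (\<Sum>i=1..n. kern n i \<omega>)"
proof -
  have "K c1 * (real n * small_ball n / 2) \<le> K c1 * neighbours n \<omega>"
    using assms kernel_bounds(3) by (intro mult_left_mono) (auto simp: crowded_def)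
  also have "\<dots> = (\<Sum>i=1..n. K c1 * indicator (cball x (c1 * h n)) (X i \<omega>))"
    by (simp add: neighbours_def sum_distrib_left)
  also have "\<dots> \<le> (\<Sum>i=1..n. kern n i \<omega>)"
  proof (rule sum_mono)
    fix i
    have "K c1 \<le> kern n i \<omega>" if "X i \<omega> \<in> cball x (c1 * h n)"
      using that h_pos[of n]
      by (intro kernel_bounds(4)) (auto simp: dist_norm divide_le_eq mult.commute)
    then show "K c1 * indicator (cball x (c1 * h n)) (X i \<omega>) \<le> kern n i \<omega>"
      using kern_nonneg[of i \<omega> n] by (auto simp: indicator_def)
  qed
  finally show ?thesis .
qed

text \<open>
  The weights sum to one, so the sum of their squares is at most the largest of them, and that is at
  most \<open>K 0\<close> divided by the denominator.
\<close>

lemma sum_weight_squares: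
  assumes np: "0 < real n * small_ball n" and "\<omega> \<in> crowded n"
  shows "(\<Sum>i=1..n. (weight n i \<omega>)\<^sup>2) \<le> 2 * K 0 / (K c1 * (real n * small_ball n))"
proof -
  define D where "D = (\<Sum>i=1..n. kern n i \<omega>)"
  have D: "K c1 * (real n * small_ball n / 2) \<le> D"
    unfolding D_def using assms by (intro kern_sum_lower)
  have pos: "0 < K c1 * (real n * small_ball n / 2)"
    using np kernel_bounds(3) by (simp only: mult_pos_pos half_gt_zero)
  have K0: "0 \<le> K 0" using kernel by (simp add: admissible_kernel_def)
  have "(weight n i \<omega>)\<^sup>2 \<le> K 0 / D * weight n i \<omega>" for i
  proof -
    have "weight n i \<omega> \<le> K 0 / D" "0 \<le> weight n i \<omega>"
      unfolding weight_def D_def[symmetric] using D pos kern_nonneg[of i \<omega> n] h_pos[of n]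
      by (auto intro!: divide_right_mono kernel_bounds(5))
    then show ?thesis unfolding power2_eq_square by (rule mult_right_mono)
  qed
  then have "(\<Sum>i=1..n. (weight n i \<omega>)\<^sup>2) \<le> (\<Sum>i=1..n. K 0 / D * weight n i \<omega>)"
    by (intro sum_mono)
  also have "\<dots> = K 0 / D * (D / D)"
    unfolding weight_def D_def[symmetric]
    by (simp add: sum_distrib_left[symmetric] sum_divide_distrib[symmetric] D_def)
  also have "\<dots> = K 0 / D" using D pos by simp
  also have "\<dots> \<le> K 0 / (K c1 * (real n * small_ball n / 2))"
    using D pos K0 by (intro divide_left_mono) auto
  finally show ?thesis by (simp add: mult.commute)
qed


section \<open>The conditional risk\<close>

text \<open>
  Conditional expectations are characterised by their integrals over design events \<open>A\<close>. Restricted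
  to \<open>A\<close>, the noise is a sum of terms \<open>Z i = 1_A * weight i * \<epsilon> i\<close>. These are orthogonal: the
  factors determined by the design are bounded and independent of the errors, and distinct errors are
  uncorrelated. Only the diagonal terms remain.
\<close>

lemma noise_conditional_second_moment:
  "AE \<omega> in M. ennreal (noise_variance * (\<Sum>i=1..n. (weight n i \<omega>)\<^sup>2)) =
     nn_cond_exp M (design n) (\<lambda>\<omega>. ennreal ((noise n \<omega>)\<^sup>2)) \<omega>"
proof -
  interpret finite_measure_subalgebra M "design n"
    by unfold_locales (rule subalgebra_design)
  have w_meas_M [measurable]: "weight n i \<in> borel_measurable M" if "i \<in> {1..n}" for i
    using measurable_from_subalg[OF subalgebra_design weight_measurable[OF that]] .
  have noise_meas: "noise n \<in> borel_measurable M"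
    unfolding noise_def by (intro borel_measurable_sum borel_measurable_times) auto
  have indep: "indep_set (sets (generated_algebra M X {1..})) (sets (generated_algebra M \<epsilon> {1..}))"
    using data by (simp add: regression_data_def)
  \<comment> \<open>Bounded design-measurable factors split off from products of errors.\<close>
  have split: "expectation (\<lambda>\<omega>. u \<omega> * (\<epsilon> i \<omega> * \<epsilon> j \<omega>)) = expectation u * expectation (\<lambda>\<omega>. \<epsilon> i \<omega> * \<epsilon> j \<omega>)"
    "integrable M (\<lambda>\<omega>. u \<omega> * (\<epsilon> i \<omega> * \<epsilon> j \<omega>))"
    if u: "u \<in> borel_measurable (design n)" "\<And>\<omega>. \<bar>u \<omega>\<bar> \<le> 1" and ij: "i \<in> {1..n}" "j \<in> {1..n}" for u i j
  proof -
    have um: "u \<in> borel_measurable (generated_algebra M X {1..})"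
      by (rule measurable_from_subalg[OF subalgebra_generated_algebra_mono u(1)]) auto
    have uM: "u \<in> borel_measurable M"
      by (rule measurable_from_subalg[OF subalgebra_design u(1)])
    have ui: "integrable M u"
      by (rule integrable_const_bound[where B=1]) (use u uM in auto)
    have em: "(\<lambda>\<omega>. \<epsilon> i \<omega> * \<epsilon> j \<omega>) \<in> borel_measurable (generated_algebra M \<epsilon> {1..})"
      using ij by (intro borel_measurable_times measurable_generated_algebra) auto
    have ei: "integrable M (\<lambda>\<omega>. \<epsilon> i \<omega> * \<epsilon> j \<omega>)"
      using ij by (intro integrable_mult_square_integrable eps_moments eps_measurable) auto
    show "expectation (\<lambda>\<omega>. u \<omega> * (\<epsilon> i \<omega> * \<epsilon> j \<omega>)) = expectation u * expectation (\<lambda>\<omega>. \<epsilon> i \<omega> * \<epsilon> j \<omega>)"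
      by (rule indep_set_expectation_mult[OF indep _ _ um ui em ei]) auto
    show "integrable M (\<lambda>\<omega>. u \<omega> * (\<epsilon> i \<omega> * \<epsilon> j \<omega>))"
      by (rule indep_set_expectation_mult[OF indep _ _ um ui em ei]) auto
  qed
  show ?thesis
  proof (rule nn_cond_exp_charact)
    fix A assume A: "A \<in> sets (design n)"
    then have A_M [measurable]: "A \<in> events"
      using subalgebra_design by (auto simp: subalgebra_def)
    define Z where "Z i \<omega> = indicator A \<omega> * weight n i \<omega> * \<epsilon> i \<omega>" for i \<omega>
    define u where "u i j \<omega> = indicator A \<omega> * (weight n i \<omega> * weight n j \<omega>)" for i j \<omega>
    have u_meas: "u i j \<in> borel_measurable (design n)" if "i \<in> {1..n}" "j \<in> {1..n}" for i j
      unfolding u_def using A that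
      by (intro borel_measurable_times borel_measurable_indicator weight_measurable)
    have u_bound: "\<bar>u i j \<omega>\<bar> \<le> 1" if "i \<in> {1..n}" "j \<in> {1..n}" for i j \<omega>
      using weight_bounds[OF that(1), of \<omega>] weight_bounds[OF that(2), of \<omega>]
      by (auto simp: u_def indicator_def abs_mult intro: mult_le_one)
    have u_nonneg: "0 \<le> u i i \<omega>" for i \<omega>
      by (simp add: u_def)
    have ZZ: "Z i \<omega> * Z j \<omega> = u i j \<omega> * (\<epsilon> i \<omega> * \<epsilon> j \<omega>)" for i j \<omega>
      by (simp add: Z_def u_def indicator_def)
    have Z_meas: "Z i \<in> borel_measurable M" if "i \<in> {1..n}" for i
      unfolding Z_def using that w_meas_M[OF that] eps_measurable[of i] by auto
    have Z_sq: "integrable M (\<lambda>\<omega>. (Z i \<omega>)\<^sup>2)" if "i \<in> {1..n}" for i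
      unfolding power2_eq_square ZZ using that by (intro split(2) u_meas u_bound)
    have orth: "expectation (\<lambda>\<omega>. Z i \<omega> * Z j \<omega>) = 0" if "i \<in> {1..n}" "j \<in> {1..n}" "i \<noteq> j" for i j
    proof -
      have "expectation (\<lambda>\<omega>. \<epsilon> i \<omega> * \<epsilon> j \<omega>) = 0"
        using indep_vars_expectation_mult[OF eps_indep _ _ that(3), of "\<lambda>t. t"] that eps_moments
        by auto
      then show ?thesis
        unfolding ZZ using split(1)[OF u_meas u_bound, of i j i j] that by simp
    qed
    have second: "expectation (\<lambda>\<omega>. (Z i \<omega>)\<^sup>2) = expectation (\<lambda>\<omega>. noise_variance * u i i \<omega>)"
      if "i \<in> {1..n}" for i
    proof -
      have "expectation (\<lambda>\<omega>. \<epsilon> i \<omega> * \<epsilon> i \<omega>) = noise_variance"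
        using eps_second_moment[of i] that by (simp add: power2_eq_square)
      then show ?thesis
        unfolding power2_eq_square ZZ using split(1)[OF u_meas u_bound, of i i i i] that by simp
    qed
    have u_int: "integrable M (u i i)" if "i \<in> {1..n}" for i
      using that measurable_from_subalg[OF subalgebra_design u_meas[OF that that]] u_bound[OF that that]
      by (intro integrable_const_bound[where B=1]) auto
    note sum_sq = second_moment_sum_orthogonal[of "{1..n}" Z M, OF _ Z_meas Z_sq orth]
    have "(\<integral>\<^sup>+ \<omega> \<in> A. ennreal ((noise n \<omega>)\<^sup>2) \<partial>M) = (\<integral>\<^sup>+ \<omega>. ennreal ((\<Sum>i=1..n. Z i \<omega>)\<^sup>2) \<partial>M)"
      by (intro nn_integral_cong) (auto simp: Z_def noise_def indicator_def)
    also have "\<dots> = ennreal (\<Sum>i=1..n. expectation (\<lambda>\<omega>. (Z i \<omega>)\<^sup>2))"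
      using sum_sq by (subst nn_integral_eq_integral) auto
    also have "\<dots> = ennreal (expectation (\<lambda>\<omega>. \<Sum>i=1..n. noise_variance * u i i \<omega>))"
      using u_int second by (simp add: Bochner_Integration.integral_sum)
    also have "\<dots> = (\<integral>\<^sup>+ \<omega>. ennreal (\<Sum>i=1..n. noise_variance * u i i \<omega>) \<partial>M)"
      using u_int u_nonneg noise_variance_nonneg
      by (subst nn_integral_eq_integral) (auto intro!: AE_I2 sum_nonneg mult_nonneg_nonneg)
    also have "\<dots> = (\<integral>\<^sup>+ \<omega> \<in> A. ennreal (noise_variance * (\<Sum>i=1..n. (weight n i \<omega>)\<^sup>2)) \<partial>M)"
      by (intro nn_integral_cong)
         (auto simp: u_def indicator_def sum_distrib_left power2_eq_square)
    finally show "(\<integral>\<^sup>+ \<omega> \<in> A. ennreal ((noise n \<omega>)\<^sup>2) \<partial>M) =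
      (\<integral>\<^sup>+ \<omega> \<in> A. ennreal (noise_variance * (\<Sum>i=1..n. (weight n i \<omega>)\<^sup>2)) \<partial>M)" .
  next
    show "(\<lambda>\<omega>. ennreal ((noise n \<omega>)\<^sup>2)) \<in> borel_measurable M"
      using noise_meas by measurable
    have "(\<lambda>\<omega>. \<Sum>i=1..n. (weight n i \<omega>)\<^sup>2) \<in> borel_measurable (design n)"
      by (intro borel_measurable_sum borel_measurable_power weight_measurable)
    then show "(\<lambda>\<omega>. ennreal (noise_variance * (\<Sum>i=1..n. (weight n i \<omega>)\<^sup>2)))
        \<in> borel_measurable (design n)"
      by measurable
  qed
qed

text \<open>
  Twice a squared bias bound \<open>B\<close> plus twice the conditional noise variance, the latter estimated
  through \<open>sum_weight_squares\<close>. The factors two come from \<open>(a + b)\<^sup>2 \<le> 2 * a\<^sup>2 + 2 * b\<^sup>2\<close>,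
  which avoids the cross term of bias and noise.
\<close>

definition risk_bound :: "nat \<Rightarrow> real \<Rightarrow> real" where
  "risk_bound n B =
     2 * B\<^sup>2 + 4 * noise_variance * K 0 / (K c1 * (real n * small_ball n))"

text \<open>
  The only way in which \<open>g\<close> enters the risk is through its oscillation on the ball that carries the
  weights. Both the continuity assumption and the Hoelder condition are turned into this form.
\<close>

definition locally_bounded_by :: "nat \<Rightarrow> real \<Rightarrow> (L2 \<Rightarrow> real) \<Rightarrow> bool" where
  "locally_bounded_by n B g \<longleftrightarrow>
     g \<in> borel_measurable borel \<and> (\<forall>y. norm (y - x) \<le> c * h n \<longrightarrow> \<bar>g y - g x\<bar> \<le> B)"

lemma risk_bound_nonneg: "0 \<le> risk_bound n B"
proof -
  have "0 \<le> K 0" using kernel by (simp add: admissible_kernel_def)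
  then show ?thesis
    using noise_variance_nonneg kernel_bounds(3) by (simp add: risk_bound_def small_ball_def)
qed

lemma g_hat_measurable:
  assumes g: "g \<in> borel_measurable borel"
  shows "g_hat d K h X \<epsilon> x n g \<in> borel_measurable M"
proof -
  have [measurable]: "(\<lambda>\<omega>. kern n i \<omega>) \<in> borel_measurable M" if "i \<in> {1..n}" for i
    by (rule measurable_from_subalg[OF subalgebra_design kern_measurable[OF that]])
  have [measurable]: "(\<lambda>\<omega>. g (X i \<omega>)) \<in> borel_measurable M" for i
    using g by measurable
  have num: "(\<lambda>\<omega>. \<Sum>i=1..n. (g (X i \<omega>) + \<epsilon> i \<omega>) * kern n i \<omega>) \<in> borel_measurable M"
    by (intro borel_measurable_sum borel_measurable_times borel_measurable_add) auto
  have den: "(\<lambda>\<omega>. \<Sum>i=1..n. kern n i \<omega>) \<in> borel_measurable M"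
    by (intro borel_measurable_sum) auto
  show ?thesis
    unfolding g_hat_def kernel_estimate_def using num den by measurable
qed

text \<open>
  On \<open>crowded n\<close> the denominator is positive, hence the weights sum to one and \<open>g x\<close> may be
  subtracted inside the average. Terms farther than \<open>c * h n\<close> from \<open>x\<close> have weight zero.
\<close>

lemma squared_error_bound:
  assumes g: "locally_bounded_by n B g" and np: "0 < real n * small_ball n" and \<omega>: "\<omega> \<in> crowded n"
  shows "(g_hat d K h X \<epsilon> x n g \<omega> - g x)\<^sup>2 \<le> 2 * B\<^sup>2 + 2 * (noise n \<omega>)\<^sup>2"
proof -
  define D where "D = (\<Sum>i=1..n. kern n i \<omega>)"
  define bias where "bias = (\<Sum>i=1..n. weight n i \<omega> * (g (X i \<omega>) - g x))"
  have "0 < K c1 * (real n * small_ball n / 2)"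
    using np kernel_bounds(3) by (simp only: mult_pos_pos half_gt_zero)
  then have D: "0 < D"
    using kern_sum_lower[OF \<omega>] by (simp add: D_def)
  have weights: "(\<Sum>i=1..n. weight n i \<omega>) = 1"
    using D by (simp add: weight_def D_def sum_divide_distrib[symmetric])
  have "g_hat d K h X \<epsilon> x n g \<omega> = (\<Sum>i=1..n. weight n i \<omega> * (g (X i \<omega>) + \<epsilon> i \<omega>))"
    using D by (simp add: g_hat_def kernel_estimate_def weight_def D_def sum_divide_distrib mult.commute)
  also have "\<dots> = bias + g x * (\<Sum>i=1..n. weight n i \<omega>) + noise n \<omega>"
    unfolding bias_def noise_def sum_distrib_left sum.distrib[symmetric]
    by (intro sum.cong refl) (simp add: algebra_simps)
  finally have err: "g_hat d K h X \<epsilon> x n g \<omega> - g x = bias + noise n \<omega>"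
    using weights by simp
  have "\<bar>bias\<bar> \<le> (\<Sum>i=1..n. \<bar>weight n i \<omega> * (g (X i \<omega>) - g x)\<bar>)"
    unfolding bias_def by (rule sum_abs)
  also have "\<dots> \<le> (\<Sum>i=1..n. weight n i \<omega> * B)"
  proof (rule sum_mono)
    fix i assume i: "i \<in> {1..n}"
    show "\<bar>weight n i \<omega> * (g (X i \<omega>) - g x)\<bar> \<le> weight n i \<omega> * B"
    proof (cases "norm (X i \<omega> - x) \<le> c * h n")
      case True
      then have "\<bar>g (X i \<omega>) - g x\<bar> \<le> B" using g by (simp add: locally_bounded_by_def)
      then show ?thesis using weight_bounds(1)[OF i, of \<omega>] by (simp add: abs_mult mult_left_mono)
    next
      case False
      then have "kern n i \<omega> = 0"
        using h_pos[of n] by (intro kernel_bounds(6)) (simp add: less_divide_eq norm_minus_commute)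
      then show ?thesis by (simp add: weight_def)
    qed
  qed
  also have "\<dots> = B"
    using weights by (simp add: sum_distrib_right[symmetric])
  finally have "\<bar>bias\<bar> \<le> \<bar>B\<bar>" by linarith
  then have "bias\<^sup>2 \<le> B\<^sup>2" by (simp only: abs_le_square_iff)
  moreover have "(bias + noise n \<omega>)\<^sup>2 \<le> 2 * bias\<^sup>2 + 2 * (noise n \<omega>)\<^sup>2"
    using zero_le_power2[of "bias - noise n \<omega>"] by (simp add: power2_eq_square algebra_simps)
  ultimately show ?thesis unfolding err by linarith
qed

text \<open>
  Monotonicity of the conditional expectation is applied to a bound holding everywhere: outside
  \<open>crowded n\<close> the bias is replaced by \<open>\<infinity>\<close>. Since that event belongs to the design, the
  modified bias passes through the conditional expectation unchanged.
\<close>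

lemma cond_mse_bound:
  assumes g: "locally_bounded_by n B g" and np: "0 < real n * small_ball n"
  shows "AE \<omega> in M. \<omega> \<in> crowded n \<longrightarrow>
    cond_mse M d K h X \<epsilon> x n g \<omega> \<le> ennreal (risk_bound n B)"
proof -
  interpret sub: finite_measure_subalgebra M "design n"
    by unfold_locales (rule subalgebra_design)
  define f where "f \<omega> = ennreal ((g_hat d K h X \<epsilon> x n g \<omega> - g x)\<^sup>2)" for \<omega>
  define bias where "bias \<omega> = (if \<omega> \<in> crowded n then ennreal (2 * B\<^sup>2) else \<infinity>)" for \<omega>
  define S where "S \<omega> = ennreal ((noise n \<omega>)\<^sup>2)" for \<omega>
  have g_meas: "g \<in> borel_measurable borel" using g by (simp add: locally_bounded_by_def)
  note [measurable] = g_hat_measurable[OF g_meas]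
  have [measurable]: "f \<in> borel_measurable M" unfolding f_def by measurable
  have w_meas [measurable]: "weight n i \<in> borel_measurable M" if "i \<in> {1..n}" for i
    using measurable_from_subalg[OF subalgebra_design weight_measurable[OF that]] .
  have "noise n \<in> borel_measurable M"
    unfolding noise_def by (intro borel_measurable_sum borel_measurable_times) auto
  then have [measurable]: "S \<in> borel_measurable M" unfolding S_def by measurable
  note [measurable] = crowded_in_design
  have bias_meas [measurable]: "bias \<in> borel_measurable (design n)" unfolding bias_def by measurable
  have [measurable]: "bias \<in> borel_measurable M"
    by (rule measurable_from_subalg[OF subalgebra_design bias_meas])
  have "f \<omega> \<le> bias \<omega> + 2 * S \<omega>" for \<omega>
  proof (cases "\<omega> \<in> crowded n")
    case True
    have "f \<omega> \<le> ennreal (2 * B\<^sup>2 + 2 * (noise n \<omega>)\<^sup>2)"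
      unfolding f_def using squared_error_bound[OF g np True] by (rule ennreal_leI)
    also have "\<dots> = bias \<omega> + 2 * S \<omega>"
      using True by (simp add: bias_def S_def ennreal_plus ennreal_mult)
    finally show ?thesis .
  qed (simp add: bias_def)
  then have "AE \<omega> in M. nn_cond_exp M (design n) f \<omega>
      \<le> nn_cond_exp M (design n) (\<lambda>\<omega>. bias \<omega> + 2 * S \<omega>) \<omega>"
    by (intro sub.nn_cond_exp_mono AE_I2) measurable
  moreover have "AE \<omega> in M. nn_cond_exp M (design n) bias \<omega> + nn_cond_exp M (design n) (\<lambda>\<omega>. 2 * S \<omega>) \<omega> =
      nn_cond_exp M (design n) (\<lambda>\<omega>. bias \<omega> + 2 * S \<omega>) \<omega>"
    by (rule sub.nn_cond_exp_sum) measurable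
  moreover have "AE \<omega> in M. bias \<omega> = nn_cond_exp M (design n) bias \<omega>"
    by (rule sub.nn_cond_exp_F_meas) measurable
  moreover have "AE \<omega> in M. 2 * nn_cond_exp M (design n) S \<omega> = nn_cond_exp M (design n) (\<lambda>\<omega>. 2 * S \<omega>) \<omega>"
    by (rule sub.nn_cond_exp_prod) measurable
  moreover have "AE \<omega> in M. ennreal (noise_variance * (\<Sum>i=1..n. (weight n i \<omega>)\<^sup>2)) =
      nn_cond_exp M (design n) S \<omega>"
    unfolding S_def by (rule noise_conditional_second_moment)
  ultimately have "AE \<omega> in M. nn_cond_exp M (design n) f \<omega>
      \<le> bias \<omega> + 2 * ennreal (noise_variance * (\<Sum>i=1..n. (weight n i \<omega>)\<^sup>2))"
    by eventually_elim simp
  then show ?thesis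
  proof eventually_elim
    case (elim \<omega>)
    show ?case
    proof
      assume \<omega>: "\<omega> \<in> crowded n"
      let ?W = "\<Sum>i=1..n. (weight n i \<omega>)\<^sup>2"
      have "noise_variance * ?W \<le> noise_variance * (2 * K 0 / (K c1 * (real n * small_ball n)))"
        using noise_variance_nonneg sum_weight_squares[OF np \<omega>] by (rule mult_left_mono[rotated])
      then have le: "2 * B\<^sup>2 + 2 * (noise_variance * ?W) \<le> risk_bound n B"
        by (simp add: risk_bound_def)
      have "bias \<omega> + 2 * ennreal (noise_variance * ?W) = ennreal (2 * B\<^sup>2 + 2 * (noise_variance * ?W))"
        using \<omega> noise_variance_nonneg
        by (simp add: bias_def ennreal_plus ennreal_mult sum_nonneg)
      also have "\<dots> \<le> ennreal (risk_bound n B)"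
        using le by (rule ennreal_leI)
      finally show "cond_mse M d K h X \<epsilon> x n g \<omega> \<le> ennreal (risk_bound n B)"
        using elim unfolding cond_mse_def f_def by (rule order_trans[rotated])
    qed
  qed
qed

text \<open>
  The exceptional null set of \<open>cond_mse_bound\<close> depends on \<open>g\<close>. The essential supremum is made for
  this: it lies below any measurable function that dominates each member almost surely.
\<close>

lemma ess_Sup_cond_mse_bound:
  assumes G: "\<And>g. g \<in> G \<Longrightarrow> locally_bounded_by n B g" and np: "0 < real n * small_ball n"
  shows "AE \<omega> in M. \<omega> \<in> crowded n \<longrightarrow>
    ess_Sup M (cond_mse M d K h X \<epsilon> x n ` G) \<omega> \<le> ennreal (risk_bound n B)"
proof -
  define V :: "'a \<Rightarrow> ennreal" where "V \<omega> = (if \<omega> \<in> crowded n then ennreal (risk_bound n B) else \<infinity>)" for \<omega>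
  have V: "V \<in> borel_measurable M" unfolding V_def by measurable
  have "AE \<omega> in M. cond_mse M d K h X \<epsilon> x n g \<omega> \<le> V \<omega>" if "g \<in> G" for g
    using cond_mse_bound[OF G[OF that] np] by eventually_elim (simp add: V_def)
  moreover have "is_ess_Sup M (cond_mse M d K h X \<epsilon> x n ` G) (ess_Sup M (cond_mse M d K h X \<epsilon> x n ` G))"
    by (rule is_ess_Sup_ess_Sup) (auto simp: finite_measure_axioms cond_mse_def)
  ultimately have "AE \<omega> in M. ess_Sup M (cond_mse M d K h X \<epsilon> x n ` G) \<omega> \<le> V \<omega>"
    using V unfolding is_ess_Sup_def by blast
  then show ?thesis by eventually_elim (auto simp: V_def split: if_splits)
qed

text \<open>
  Markov's inequality is applied on \<open>crowded n\<close> only, where integrating the squared error equals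
  integrating its conditional expectation; the remaining event is paid for by its probability.
\<close>

lemma prob_error_bound:
  assumes g: "locally_bounded_by n B g" and np: "0 < real n * small_ball n" and "0 < t"
  shows "emeasure M {\<omega> \<in> space M. t < \<bar>g_hat d K h X \<epsilon> x n g \<omega> - g x\<bar>}
    \<le> ennreal (4 / (real n * small_ball n) + risk_bound n B / t\<^sup>2)"
proof -
  interpret sub: finite_measure_subalgebra M "design n"
    by unfold_locales (rule subalgebra_design)
  define f where "f \<omega> = ennreal ((g_hat d K h X \<epsilon> x n g \<omega> - g x)\<^sup>2)" for \<omega>
  have g_meas: "g \<in> borel_measurable borel" using g by (simp add: locally_bounded_by_def)
  note [measurable] = g_hat_measurable[OF g_meas]
  have [measurable]: "f \<in> borel_measurable M" unfolding f_def by measurable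
  have "(\<integral>\<^sup>+ \<omega>. f \<omega> * indicator (crowded n) \<omega> \<partial>M) =
      (\<integral>\<^sup>+ \<omega>. indicator (crowded n) \<omega> * nn_cond_exp M (design n) f \<omega> \<partial>M)"
    using crowded_in_design
    by (subst sub.nn_cond_exp_intg) (auto simp: mult.commute)
  also have "\<dots> \<le> (\<integral>\<^sup>+ \<omega>. ennreal (risk_bound n B) \<partial>M)"
    using cond_mse_bound[OF g np]
    by (intro nn_integral_mono_AE)
       (auto simp: cond_mse_def f_def[abs_def] indicator_def elim: eventually_mono)
  also have "\<dots> = ennreal (risk_bound n B)"
    by (simp add: emeasure_space_1)
  finally have int: "(\<integral>\<^sup>+ \<omega>. f \<omega> * indicator (crowded n) \<omega> \<partial>M) \<le> ennreal (risk_bound n B)" .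
  have sub: "{\<omega> \<in> space M. t < \<bar>g_hat d K h X \<epsilon> x n g \<omega> - g x\<bar>} \<subseteq>
      (space M - crowded n) \<union> {\<omega> \<in> crowded n. 1 \<le> ennreal (1 / t\<^sup>2) * f \<omega>}"
  proof
    fix \<omega> assume \<omega>: "\<omega> \<in> {\<omega> \<in> space M. t < \<bar>g_hat d K h X \<epsilon> x n g \<omega> - g x\<bar>}"
    then have "t\<^sup>2 \<le> (g_hat d K h X \<epsilon> x n g \<omega> - g x)\<^sup>2"
      using \<open>0 < t\<close> by (subst abs_le_square_iff[symmetric]) simp
    then have "1 \<le> 1 / t\<^sup>2 * (g_hat d K h X \<epsilon> x n g \<omega> - g x)\<^sup>2"
      using \<open>0 < t\<close> by (simp add: le_divide_eq)
    then have "ennreal 1 \<le> ennreal (1 / t\<^sup>2 * (g_hat d K h X \<epsilon> x n g \<omega> - g x)\<^sup>2)"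
      by (rule ennreal_leI)
    also have "\<dots> = ennreal (1 / t\<^sup>2) * f \<omega>"
      unfolding f_def by (rule ennreal_mult) auto
    finally show "\<omega> \<in> (space M - crowded n) \<union> {\<omega> \<in> crowded n. 1 \<le> ennreal (1 / t\<^sup>2) * f \<omega>}"
      using \<omega> by auto
  qed
  have large: "{\<omega> \<in> crowded n. 1 \<le> ennreal (1 / t\<^sup>2) * f \<omega>} \<in> events"
  proof -
    have "crowded n \<inter> {\<omega> \<in> space M. 1 \<le> ennreal (1 / t\<^sup>2) * f \<omega>} \<in> events" by measurable
    moreover have "crowded n \<inter> {\<omega> \<in> space M. 1 \<le> ennreal (1 / t\<^sup>2) * f \<omega>} =
        {\<omega> \<in> crowded n. 1 \<le> ennreal (1 / t\<^sup>2) * f \<omega>}"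
      by (auto simp: crowded_def)
    ultimately show ?thesis by simp
  qed
  have "emeasure M {\<omega> \<in> space M. t < \<bar>g_hat d K h X \<epsilon> x n g \<omega> - g x\<bar>} \<le>
      emeasure M (space M - crowded n) + emeasure M {\<omega> \<in> crowded n. 1 \<le> ennreal (1 / t\<^sup>2) * f \<omega>}"
    using large by (intro order_trans[OF emeasure_mono[OF sub] emeasure_subadditive]) auto
  also have "\<dots> \<le> ennreal (4 / (real n * small_ball n)) + ennreal (1 / t\<^sup>2) * ennreal (risk_bound n B)"
  proof (rule add_mono)
    show "emeasure M (space M - crowded n) \<le> ennreal (4 / (real n * small_ball n))"
      unfolding emeasure_eq_measure using prob_not_crowded[OF np] by (rule ennreal_leI)
    have "emeasure M {\<omega> \<in> crowded n. 1 \<le> ennreal (1 / t\<^sup>2) * f \<omega>} \<le>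
        ennreal (1 / t\<^sup>2) * (\<integral>\<^sup>+ \<omega>. f \<omega> * indicator (crowded n) \<omega> \<partial>M)"
      by (rule nn_integral_Markov_inequality) measurable
    also have "\<dots> \<le> ennreal (1 / t\<^sup>2) * ennreal (risk_bound n B)"
      by (rule mult_left_mono[OF int]) simp
    finally show "emeasure M {\<omega> \<in> crowded n. 1 \<le> ennreal (1 / t\<^sup>2) * f \<omega>} \<le>
        ennreal (1 / t\<^sup>2) * ennreal (risk_bound n B)" .
  qed
  also have "\<dots> = ennreal (4 / (real n * small_ball n) + risk_bound n B / t\<^sup>2)"
    using np risk_bound_nonneg by (simp add: ennreal_mult[symmetric] ennreal_plus[symmetric] del: ennreal_plus)
  finally show ?thesis .
qed

lemma prob_exceeds_bound:
  assumes Z: "AE \<omega> in M. \<omega> \<in> crowded n \<longrightarrow> Z \<omega> \<le> ennreal v" and np: "0 < real n * small_ball n"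
  shows "prob {\<omega> \<in> space M. ennreal v < Z \<omega>} \<le> 4 / (real n * small_ball n)"
proof -
  have "prob {\<omega> \<in> space M. ennreal v < Z \<omega>} \<le> prob (space M - crowded n)"
  proof (rule finite_measure_mono_AE)
    show "AE \<omega> in M. \<omega> \<in> {\<omega> \<in> space M. ennreal v < Z \<omega>} \<longrightarrow> \<omega> \<in> space M - crowded n"
      using Z by eventually_elim auto
  qed measurable
  then show ?thesis using prob_not_crowded[OF np] by linarith
qed


section \<open>Asymptotics\<close>

lemma tail_tendsto_zero:
  assumes "filterlim (\<lambda>n. real n * small_ball n) at_top sequentially"
  shows "(\<lambda>n. 4 / (real n * small_ball n)) \<longlonglongrightarrow> 0"
  by (rule tendsto_divide_0[OF tendsto_const filterlim_at_top_imp_at_infinity[OF assms]])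

lemma risk_bound_tendsto_zero:
  assumes "filterlim (\<lambda>n. real n * small_ball n) at_top sequentially" and "B \<longlonglongrightarrow> 0"
  shows "(\<lambda>n. risk_bound n (B n)) \<longlonglongrightarrow> 0"
proof -
  have "(\<lambda>n. 2 * (B n)\<^sup>2 + noise_variance * K 0 / K c1 * (4 / (real n * small_ball n)))
      \<longlonglongrightarrow> 2 * 0\<^sup>2 + noise_variance * K 0 / K c1 * 0"
    by (intro tendsto_intros assms tail_tendsto_zero)
  then show ?thesis by (simp add: risk_bound_def mult_ac)
qed

text \<open>
  The event \<open>{\<omega>. \<eta> < Z n \<omega>}\<close> is, up to a null set, disjoint from \<open>crowded n\<close> as soon as the
  deterministic bound \<open>v n\<close> is below \<open>\<eta>\<close>.
\<close>

lemma in_prob_to_zeroI: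
  assumes np: "filterlim (\<lambda>n. real n * small_ball n) at_top sequentially"
    and v: "v \<longlonglongrightarrow> 0"
    and Z: "\<forall>\<^sub>F n in sequentially. AE \<omega> in M. \<omega> \<in> crowded n \<longrightarrow> Z n \<omega> \<le> ennreal (v n)"
  shows "in_prob_to_zero M Z"
  unfolding in_prob_to_zero_def
proof (intro allI impI)
  fix \<eta> :: real assume "0 < \<eta>"
  then have "\<forall>\<^sub>F n in sequentially. v n < \<eta>"
    using v by (rule order_tendstoD(2)[rotated])
  moreover have "\<forall>\<^sub>F n in sequentially. 0 < real n * small_ball n"
    using np by (simp add: filterlim_at_top_dense)
  ultimately have "\<forall>\<^sub>F n in sequentially.
      prob {\<omega> \<in> space M. ennreal \<eta> < Z n \<omega>} \<le> 4 / (real n * small_ball n)"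
    using Z
  proof eventually_elim
    case (elim n)
    have "AE \<omega> in M. \<omega> \<in> crowded n \<longrightarrow> Z n \<omega> \<le> ennreal \<eta>"
      using elim(3)
      by eventually_elim (use elim(1) in \<open>auto intro: order_trans ennreal_leI[OF less_imp_le]\<close>)
    then show ?case using elim(2) by (rule prob_exceeds_bound)
  qed
  then show "(\<lambda>n. prob {\<omega> \<in> space M. ennreal \<eta> < Z n \<omega>}) \<longlonglongrightarrow> 0"
    by (intro tendsto_sandwich[OF _ _ tendsto_const tail_tendsto_zero[OF np]]) auto
qed

text \<open>
  Any point of the ball is \<open>x\<close> plus \<open>c * h n\<close> times a vector of norm at most one, so one value of
  the scaling \<open>\<delta>\<close> in the smoothness conditions controls the whole ball.
\<close>

lemma locally_bounded_byI:
  assumes "g \<in> borel_measurable borel"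
    and "\<And>y. norm y \<le> 1 \<Longrightarrow> \<bar>g (x + (c * h n) *\<^sub>R y) - g x\<bar> \<le> B"
  shows "locally_bounded_by n B g"
  unfolding locally_bounded_by_def
proof (intro conjI allI impI)
  fix y assume y: "norm (y - x) \<le> c * h n"
  define \<delta> where "\<delta> = c * h n"
  have pos: "0 < \<delta>" using c_pos h_pos by (simp add: \<delta>_def)
  have "norm ((y - x) /\<^sub>R \<delta>) \<le> 1"
    using y pos by (simp add: \<delta>_def[symmetric] divide_inverse_commute[symmetric])
  from assms(2)[OF this, folded \<delta>_def] show "\<bar>g y - g x\<bar> \<le> B"
    using pos by simp
qed (rule assms(1))

lemma holder_class_locally_bounded:
  assumes "g \<in> holder_class C x \<alpha>" and "c * h n \<le> 1"
  shows "locally_bounded_by n (C * (c * h n) powr \<alpha>) g"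
  using assms c_pos h_pos[of n]
  by (intro locally_bounded_byI) (auto simp: holder_class_def)

lemma bandwidth_at_right:
  assumes "h \<longlonglongrightarrow> 0"
  shows "filterlim (\<lambda>n. c * h n) (at_right 0) sequentially"
proof -
  have "(\<lambda>n. c * h n) \<longlonglongrightarrow> c * 0" by (intro tendsto_intros assms)
  then show ?thesis
    using c_pos h_pos by (intro tendsto_imp_filterlim_at_right) auto
qed

lemma eventually_holder_class_locally_bounded:
  assumes "h \<longlonglongrightarrow> 0"
  shows "\<forall>\<^sub>F n in sequentially. \<forall>g\<in>holder_class C x \<alpha>.
    locally_bounded_by n (C * (c * h n) powr \<alpha>) g"
proof -
  have "(\<lambda>n. c * h n) \<longlonglongrightarrow> c * 0" by (intro tendsto_intros assms)
  then have "\<forall>\<^sub>F n in sequentially. c * h n < 1"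
    by (rule order_tendstoD(2)) simp
  then show ?thesis
    by eventually_elim (auto intro: holder_class_locally_bounded)
qed

text \<open>
  The supremum in the continuity condition is an extended real that may be infinite for large
  \<open>\<delta>\<close>; as it tends to zero, its real part is eventually a genuine bound.
\<close>

lemma eventually_continuous_locally_bounded:
  assumes g: "g \<in> borel_measurable borel" and cont: "continuous_functional_at g x" and h: "h \<longlonglongrightarrow> 0"
  obtains B where "B \<longlonglongrightarrow> 0" "\<forall>\<^sub>F n in sequentially. locally_bounded_by n (B n) g"
proof
  define s where "s n = (SUP y\<in>{y. norm y \<le> 1}. ennreal \<bar>g (x + (c * h n) *\<^sub>R y) - g x\<bar>)" for n
  have s: "s \<longlonglongrightarrow> 0"
    using filterlim_compose[OF cont[unfolded continuous_functional_at_def] bandwidth_at_right[OF h]]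
    by (simp add: s_def[abs_def])
  then show "(\<lambda>n. enn2real (s n)) \<longlonglongrightarrow> 0"
    by (intro tendsto_enn2real) simp_all
  have "\<forall>\<^sub>F n in sequentially. s n < 1"
    using s by (rule order_tendstoD(2)) simp
  then show "\<forall>\<^sub>F n in sequentially. locally_bounded_by n (enn2real (s n)) g"
  proof eventually_elim
    case (elim n)
    have fin: "s n < top" using elim by (rule less_trans) simp
    show ?case
    proof (rule locally_bounded_byI[OF g])
      fix y :: L2 assume "norm y \<le> 1"
      then have "ennreal \<bar>g (x + (c * h n) *\<^sub>R y) - g x\<bar> \<le> s n"
        unfolding s_def by (intro SUP_upper) simp
      also have "s n = ennreal (enn2real (s n))"
        using fin by simp
      finally show "\<bar>g (x + (c * h n) *\<^sub>R y) - g x\<bar> \<le> enn2real (s n)"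
        by (simp add: ennreal_le_iff)
    qed
  qed
qed

lemma holder_bound_tendsto_zero:
  assumes "h \<longlonglongrightarrow> 0" "0 < \<alpha>"
  shows "(\<lambda>n. C * (c * h n) powr \<alpha>) \<longlonglongrightarrow> 0"
proof -
  have "(\<lambda>n. c * h n) \<longlonglongrightarrow> c * 0" by (intro tendsto_intros assms)
  then have "(\<lambda>n. (c * h n) powr \<alpha>) \<longlonglongrightarrow> 0"
    using assms c_pos h_pos
    by (intro tendsto_zero_powrI[where b=\<alpha>]) (auto intro!: always_eventually mult_nonneg_nonneg less_imp_le)
  then show ?thesis by (rule tendsto_mult_right_zero)
qed

text \<open>
  This is the step where the choice of the bandwidth enters: if \<open>n * p\<close> is at least a multiple of
  \<open>h powr (- 2 * \<alpha>)\<close>, the variance is of the order of the squared bias.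
\<close>

lemma risk_bound_balanced:
  assumes k: "0 < k" "k \<le> h n powr (2 * \<alpha>) * (real n * small_ball n)" and np: "0 < real n * small_ball n"
  shows "risk_bound n (C * (c * h n) powr \<alpha>) \<le>
    (2 * C\<^sup>2 * c powr (2 * \<alpha>) + 4 * noise_variance * K 0 / (K c1 * k)) * h n powr (2 * \<alpha>)"
proof -
  have K0: "0 \<le> K 0" using kernel by (simp add: admissible_kernel_def)
  have bias: "(C * (c * h n) powr \<alpha>)\<^sup>2 = C\<^sup>2 * c powr (2 * \<alpha>) * h n powr (2 * \<alpha>)"
    using c_pos h_pos[of n]
    by (simp add: power_mult_distrib powr_mult powr_power)
  have "1 / (real n * small_ball n) \<le> h n powr (2 * \<alpha>) / k"
    using k np by (simp add: field_simps)
  then have "4 * noise_variance * K 0 / K c1 * (1 / (real n * small_ball n)) \<le>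
      4 * noise_variance * K 0 / K c1 * (h n powr (2 * \<alpha>) / k)"
    using noise_variance_nonneg K0 kernel_bounds(3) by (intro mult_left_mono) auto
  then show ?thesis
    unfolding risk_bound_def bias by (simp add: algebra_simps)
qed

end

theorem theorem1:
  fixes M :: "'a measure"
    and X :: "nat \<Rightarrow> 'a \<Rightarrow> L2" and \<epsilon> :: "nat \<Rightarrow> 'a \<Rightarrow> real"
    and K :: "real \<Rightarrow> real" and h :: "nat \<Rightarrow> real" and x :: L2
    and c c1 \<alpha> d :: real
  assumes "prob_space M"
    and "regression_data M X \<epsilon>"
    and "0 < c" and "admissible_kernel K c"
    and "if 0 < K c then c1 = c else 0 < c1 \<and> c1 < c"
    and "\<forall>n. 0 < h n" and "h \<longlonglongrightarrow> 0"
    and "filterlim (\<lambda>n. real n * measure M {\<omega> \<in> space M. norm (X 0 \<omega> - x) \<le> c1 * h n})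
           at_top sequentially"
    and "0 < \<alpha>" and "\<alpha> \<le> 1"
  shows
    "(\<forall>g \<in> borel_measurable borel. continuous_functional_at g x \<longrightarrow>
        in_prob_to_zero M (\<lambda>n. cond_mse M d K h X \<epsilon> x n g)) \<and>
     (\<forall>C>0.
        in_prob_to_zero M (\<lambda>n. ess_Sup M (cond_mse M d K h X \<epsilon> x n ` holder_class C x \<alpha>)) \<and>
        (\<forall>\<eta>>0. (\<lambda>n. SUP g\<in>holder_class C x \<alpha>.
            emeasure M {\<omega> \<in> space M. \<eta> < \<bar>g_hat d K h X \<epsilon> x n g \<omega> - g x\<bar>}) \<longlonglongrightarrow> 0)) \<and>
     ((\<lambda>n. h n powr (2 * \<alpha>) * measure M {\<omega> \<in> space M. norm (X 0 \<omega> - x) \<le> c1 * h n})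
          \<in> \<Theta>(\<lambda>n. inverse (real n)) \<longrightarrow>
      (\<forall>C>0.
        big_O_in_prob M (\<lambda>n. ess_Sup M (cond_mse M d K h X \<epsilon> x n ` holder_class C x \<alpha>))
          (\<lambda>n. h n powr (2 * \<alpha>)) \<and>
        ((\<lambda>C1. limsup (\<lambda>n. SUP g\<in>holder_class C x \<alpha>.
            emeasure M {\<omega> \<in> space M. C1 * h n powr \<alpha> < \<bar>g_hat d K h X \<epsilon> x n g \<omega> - g x\<bar>}))
          \<longlongrightarrow> 0) (at_top :: real filter)))"
proof -
  interpret prob_space M by fact
  interpret kernel_regression M X \<epsilon> K h x c c1 d
    using assms by unfold_locales auto
  have np: "filterlim (\<lambda>n. real n * small_ball n) at_top sequentially"
    using assms(8) by (simp add: small_ball_def)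
  have np_pos: "\<forall>\<^sub>F n in sequentially. 0 < real n * small_ball n"
    using np by (simp add: filterlim_at_top_dense)
  note h = \<open>h \<longlonglongrightarrow> 0\<close>
  define H where "H = (\<lambda>C. holder_class C x \<alpha>)"
  define B where "B C n = C * (c * h n) powr \<alpha>" for C n
  define R where "R C n = ess_Sup M (cond_mse M d K h X \<epsilon> x n ` H C)" for C n
  define P where "P C n t = (SUP g\<in>H C. emeasure M {\<omega> \<in> space M. t < \<bar>g_hat d K h X \<epsilon> x n g \<omega> - g x\<bar>})"
    for C n t
  have B_lim: "B C \<longlonglongrightarrow> 0" for C
    unfolding B_def[abs_def] using h \<open>0 < \<alpha>\<close> by (rule holder_bound_tendsto_zero)
  have bounded: "\<forall>\<^sub>F n in sequentially. \<forall>g\<in>H C. locally_bounded_by n (B C n) g" for C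
    unfolding H_def B_def by (rule eventually_holder_class_locally_bounded[OF h])
  have R_bound: "\<forall>\<^sub>F n in sequentially. AE \<omega> in M. \<omega> \<in> crowded n \<longrightarrow>
      R C n \<omega> \<le> ennreal (risk_bound n (B C n))" for C
    using bounded[of C] np_pos unfolding R_def
    by eventually_elim (intro ess_Sup_cond_mse_bound, auto)
  have P_bound: "\<forall>\<^sub>F n in sequentially. \<forall>t>0. P C n t \<le>
      ennreal (4 / (real n * small_ball n) + risk_bound n (B C n) / t\<^sup>2)" for C
    using bounded[of C] np_pos unfolding P_def
    by eventually_elim (auto intro!: SUP_least prob_error_bound)

  have pointwise: "in_prob_to_zero M (\<lambda>n. cond_mse M d K h X \<epsilon> x n g)"
    if g: "g \<in> borel_measurable borel" "continuous_functional_at g x" for g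
  proof -
    obtain b where b: "b \<longlonglongrightarrow> 0" "\<forall>\<^sub>F n in sequentially. locally_bounded_by n (b n) g"
      using eventually_continuous_locally_bounded[OF g h] by blast
    have "\<forall>\<^sub>F n in sequentially. AE \<omega> in M. \<omega> \<in> crowded n \<longrightarrow>
        cond_mse M d K h X \<epsilon> x n g \<omega> \<le> ennreal (risk_bound n (b n))"
      using b(2) np_pos by eventually_elim (rule cond_mse_bound)
    then show ?thesis
      by (rule in_prob_to_zeroI[OF np risk_bound_tendsto_zero[OF np b(1)]])
  qed

  have uniform_mse: "in_prob_to_zero M (R C)" for C
    by (rule in_prob_to_zeroI[OF np risk_bound_tendsto_zero[OF np B_lim] R_bound])

  have uniform_prob: "(\<lambda>n. P C n \<eta>) \<longlonglongrightarrow> 0" if "0 < \<eta>" for C \<eta>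
  proof -
    have "(\<lambda>n. 4 / (real n * small_ball n) + risk_bound n (B C n) / \<eta>\<^sup>2) \<longlonglongrightarrow> 0 + 0 / \<eta>\<^sup>2"
      using that by (intro tendsto_intros tail_tendsto_zero risk_bound_tendsto_zero np B_lim) auto
    then have "(\<lambda>n. ennreal (4 / (real n * small_ball n) + risk_bound n (B C n) / \<eta>\<^sup>2)) \<longlonglongrightarrow> ennreal 0"
      by (intro tendsto_ennrealI) simp
    then have lim: "(\<lambda>n. ennreal (4 / (real n * small_ball n) + risk_bound n (B C n) / \<eta>\<^sup>2)) \<longlonglongrightarrow> 0"
      by simp
    have "\<forall>\<^sub>F n in sequentially.
        P C n \<eta> \<le> ennreal (4 / (real n * small_ball n) + risk_bound n (B C n) / \<eta>\<^sup>2)"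
      using P_bound[of C] by eventually_elim (use that in blast)
    then show ?thesis
      by (rule tendsto_sandwich[OF _ _ tendsto_const lim, rotated]) simp
  qed

  have rates: "big_O_in_prob M (R C) (\<lambda>n. h n powr (2 * \<alpha>)) \<and>
      ((\<lambda>C1. limsup (\<lambda>n. P C n (C1 * h n powr \<alpha>))) \<longlongrightarrow> 0) at_top"
    if theta: "(\<lambda>n. h n powr (2 * \<alpha>) * small_ball n) \<in> \<Theta>(\<lambda>n. inverse (real n))" for C
  proof -
    have "(\<lambda>n. h n powr (2 * \<alpha>) * small_ball n) \<in> \<Omega>(\<lambda>n. inverse (real n))"
      using theta by (rule bigthetaD2)
    then obtain k where k: "0 < k" "\<forall>\<^sub>F n in sequentially.
        k * norm (inverse (real n)) \<le> norm (h n powr (2 * \<alpha>) * small_ball n)"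
      by (rule landau_omega.bigE) blast
    have balance: "\<forall>\<^sub>F n in sequentially. k \<le> h n powr (2 * \<alpha>) * (real n * small_ball n)"
      using k(2) np_pos
    proof eventually_elim
      case (elim n)
      then have "0 < real n" "0 \<le> small_ball n" by (auto simp: small_ball_def zero_less_mult_iff)
      then show ?case using elim(1) by (simp add: abs_mult field_simps)
    qed
    \<comment> \<open>The summand \<open>1\<close> makes \<open>\<kappa>\<close> positive even if the errors vanish and \<open>C\<close> is zero.\<close>
    define \<kappa> where "\<kappa> = 2 * C\<^sup>2 * c powr (2 * \<alpha>) + 4 * noise_variance * K 0 / (K c1 * k) + 1"
    have "0 \<le> K 0" using kernel by (simp add: admissible_kernel_def)
    then have "0 < \<kappa>"
      using noise_variance_nonneg kernel_bounds(3) k(1) unfolding \<kappa>_def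
      by (intro add_nonneg_pos add_nonneg_nonneg) auto
    have risk: "\<forall>\<^sub>F n in sequentially. risk_bound n (B C n) \<le> \<kappa> * h n powr (2 * \<alpha>)"
      using balance np_pos
    proof eventually_elim
      case (elim n)
      have "risk_bound n (B C n) \<le> (\<kappa> - 1) * h n powr (2 * \<alpha>)"
        using risk_bound_balanced[OF k(1) elim(1,2), of C] by (simp add: B_def \<kappa>_def)
      also have "\<dots> \<le> \<kappa> * h n powr (2 * \<alpha>)" by (intro mult_right_mono) auto
      finally show ?case .
    qed
    have "big_O_in_prob M (R C) (\<lambda>n. h n powr (2 * \<alpha>))"
      unfolding big_O_in_prob_def
    proof (intro allI impI)
      fix e :: real assume "0 < e"
      have "\<forall>\<^sub>F n in sequentially. 4 / (real n * small_ball n) < e"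
        using tail_tendsto_zero[OF np] \<open>0 < e\<close> by (rule order_tendstoD(2))
      with R_bound[of C] risk np_pos have "\<forall>\<^sub>F n in sequentially.
          prob {\<omega> \<in> space M. ennreal (\<kappa> * h n powr (2 * \<alpha>)) < R C n \<omega>} < e"
      proof eventually_elim
        case (elim n)
        have "AE \<omega> in M. \<omega> \<in> crowded n \<longrightarrow> R C n \<omega> \<le> ennreal (\<kappa> * h n powr (2 * \<alpha>))"
          using elim(1)
          by eventually_elim (use elim(2) in \<open>auto intro: order_trans ennreal_leI\<close>)
        from prob_exceeds_bound[OF this elim(3)] elim(4) show ?case by linarith
      qed
      then show "\<exists>b>0. \<forall>\<^sub>F n in sequentially.
          prob {\<omega> \<in> space M. ennreal (b * h n powr (2 * \<alpha>)) < R C n \<omega>} < e"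
        using \<open>0 < \<kappa>\<close> by blast
    qed
    moreover have "((\<lambda>C1. limsup (\<lambda>n. P C n (C1 * h n powr \<alpha>))) \<longlongrightarrow> 0) at_top"
    proof (rule tendsto_sandwich[OF _ _ tendsto_const])
      have "limsup (\<lambda>n. P C n (C1 * h n powr \<alpha>)) \<le> ennreal (\<kappa> / C1\<^sup>2)" if "0 < C1" for C1
      proof -
        have "limsup (\<lambda>n. P C n (C1 * h n powr \<alpha>)) \<le>
            limsup (\<lambda>n. ennreal (4 / (real n * small_ball n) + \<kappa> / C1\<^sup>2))"
        proof (rule Limsup_mono)
          show "\<forall>\<^sub>F n in sequentially. P C n (C1 * h n powr \<alpha>) \<le>
              ennreal (4 / (real n * small_ball n) + \<kappa> / C1\<^sup>2)"
            using P_bound[of C] risk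
          proof eventually_elim
            case (elim n)
            have t: "0 < C1 * h n powr \<alpha>" using that h_pos[of n] by simp
            have sq: "(C1 * h n powr \<alpha>)\<^sup>2 = C1\<^sup>2 * h n powr (2 * \<alpha>)"
              using h_pos[of n] by (simp add: power_mult_distrib powr_power)
            have "risk_bound n (B C n) / (C1 * h n powr \<alpha>)\<^sup>2 \<le>
                \<kappa> * h n powr (2 * \<alpha>) / (C1\<^sup>2 * h n powr (2 * \<alpha>))"
              unfolding sq using elim(2) by (rule divide_right_mono) simp
            also have "\<dots> = \<kappa> / C1\<^sup>2"
              using h_pos[of n] by simp
            finally have "4 / (real n * small_ball n) + risk_bound n (B C n) / (C1 * h n powr \<alpha>)\<^sup>2 \<le>
                4 / (real n * small_ball n) + \<kappa> / C1\<^sup>2" by simp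
            with elim(1) t show ?case by (blast intro: order_trans ennreal_leI)
          qed
        qed
        also have "\<dots> = ennreal (\<kappa> / C1\<^sup>2)"
        proof (rule lim_imp_Limsup)
          have "(\<lambda>n. 4 / (real n * small_ball n) + \<kappa> / C1\<^sup>2) \<longlonglongrightarrow> 0 + \<kappa> / C1\<^sup>2"
            by (intro tendsto_intros tail_tendsto_zero np)
          then show "(\<lambda>n. ennreal (4 / (real n * small_ball n) + \<kappa> / C1\<^sup>2)) \<longlonglongrightarrow> ennreal (\<kappa> / C1\<^sup>2)"
            by (intro tendsto_ennrealI) simp
        qed simp
        finally show ?thesis .
      qed
      then show "\<forall>\<^sub>F C1 in at_top. limsup (\<lambda>n. P C n (C1 * h n powr \<alpha>)) \<le> ennreal (\<kappa> / C1\<^sup>2)"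
        by (rule eventually_mono[OF eventually_gt_at_top[of 0]])
      have "((\<lambda>C1. \<kappa> / C1\<^sup>2) \<longlongrightarrow> 0) at_top"
        by (intro tendsto_divide_0[OF tendsto_const] filterlim_at_top_imp_at_infinity
            filterlim_pow_at_top filterlim_ident) simp
      then have "((\<lambda>C1. ennreal (\<kappa> / C1\<^sup>2)) \<longlongrightarrow> ennreal 0) at_top"
        by (rule tendsto_ennrealI)
      then show "((\<lambda>C1. ennreal (\<kappa> / C1\<^sup>2)) \<longlongrightarrow> 0) at_top" by simp
    qed auto
    ultimately show ?thesis by simp
  qed

  show ?thesis
  proof (intro conjI ballI allI impI)
    show "in_prob_to_zero M (\<lambda>n. cond_mse M d K h X \<epsilon> x n g)"
      if "g \<in> borel_measurable borel" "continuous_functional_at g x" for g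
      using that by (rule pointwise)
    show "in_prob_to_zero M (\<lambda>n. ess_Sup M (cond_mse M d K h X \<epsilon> x n ` holder_class C x \<alpha>))" for C
      using uniform_mse[of C] by (simp only: R_def[abs_def] H_def)
    show "(\<lambda>n. SUP g\<in>holder_class C x \<alpha>.
        emeasure M {\<omega> \<in> space M. \<eta> < \<bar>g_hat d K h X \<epsilon> x n g \<omega> - g x\<bar>}) \<longlonglongrightarrow> 0" if "0 < \<eta>" for C \<eta>
      using uniform_prob[OF that, of C] by (simp only: P_def H_def)
    fix C
    assume "(\<lambda>n. h n powr (2 * \<alpha>) * measure M {\<omega> \<in> space M. norm (X 0 \<omega> - x) \<le> c1 * h n})
        \<in> \<Theta>(\<lambda>n. inverse (real n))"
    then have "(\<lambda>n. h n powr (2 * \<alpha>) * small_ball n) \<in> \<Theta>(\<lambda>n. inverse (real n))"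
      by (simp only: small_ball_def)
    note rates = rates[OF this, of C]
    show "big_O_in_prob M (\<lambda>n. ess_Sup M (cond_mse M d K h X \<epsilon> x n ` holder_class C x \<alpha>))
        (\<lambda>n. h n powr (2 * \<alpha>))"
      using conjunct1[OF rates] by (simp only: R_def[abs_def] H_def)
    show "((\<lambda>C1. limsup (\<lambda>n. SUP g\<in>holder_class C x \<alpha>.
        emeasure M {\<omega> \<in> space M. C1 * h n powr \<alpha> < \<bar>g_hat d K h X \<epsilon> x n g \<omega> - g x\<bar>}))
        \<longlongrightarrow> 0) at_top"
      using conjunct2[OF rates] by (simp only: P_def H_def)
  qed
qed

end
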